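(* The following identity holds: $$\int_{\mathbb{R}^{\ell}}\prod_{i=1}^{\ell}dx_i\;\mathcal{Q}^{\mathfrak{so}_{2\ell+1}}(\underline{y},\underline{x}|\gamma)\,\Psi^{\mathfrak{so}_{2\ell+1}}_{\underline\lambda}(\underline{x})=\prod_{i=1}^{\ell}\Gamma(\imath\lambda_i-\imath\gamma)\prod_{i=1}^{\ell}\Gamma(-\imath\lambda_i-\imath\gamma)\;\Psi^{\mathfrak{so}_{2\ell+1}}_{\underline\lambda}(\underline{y}).$$
   Context: Here $\imath=\sqrt{-1}$, $\underline\lambda=(\lambda_1,\ldots,\lambda_\ell)$, $\underline x=(x_1,\ldots,x_\ell)$, $\underline y=(y_1,\ldots,y_\ell)$. The Baxter operator $\mathcal{Q}^{\mathfrak{so}_{2\ell+1}}(\gamma)$ has kernel $$\mathcal{Q}^{\mathfrak{so}_{2\ell+1}}(\underline{y},\underline{x}|\gamma)=\int_{\mathbb{R}^{\ell+1}}\prod_{i=1}^{\ell+1}dz_i\,\exp\Big\{-\imath\gamma\Big(\sum_{i=1}^{\ell}y_i-2\sum_{i=1}^{\ell+1}z_i+\sum_{i=1}^{\ell}x_i\Big)\Big\}\exp\Big\{-e^{z_1}-\sum_{i=1}^{\ell}\big(e^{y_i-z_i}+e^{z_{i+1}-y_i}+e^{x_i-z_i}+e^{z_{i+1}-x_i}\big)\Big\}.$$ $\Psi^{\mathfrak{so}_{2\ell+1}}_{\underline\lambda}$ is the Weyl-group-invariant (class one principal series) Whittaker function, an eigenfunction of the $\mathfrak{so}_{2\ell+1}$-Toda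 chain Hamiltonians, given recursively by $\Psi^{\mathfrak{so}_1}=1$ and $$\Psi^{\mathfrak{so}_{2\ell+1}}_{\lambda_1,\ldots,\lambda_\ell}(\underline x)=\int_{\mathbb{R}^{\ell-1}}Q^{\mathfrak{so}_{2\ell+1}}_{\mathfrak{so}_{2\ell-1}}(\underline x,\underline w|\lambda_\ell)\,\Psi^{\mathfrak{so}_{2\ell-1}}_{\lambda_1,\ldots,\lambda_{\ell-1}}(\underline w)\,d\underline w,$$ $$Q^{\mathfrak{so}_{2\ell+1}}_{\mathfrak{so}_{2\ell-1}}(\underline{x},\underline{w}|\lambda)=\int_{\mathbb{R}^\ell}\prod_{i=1}^{\ell}dz_i\exp\Big\{-\imath\lambda\Big(\sum_{i=1}^{\ell}x_i-2\sum_{i=1}^{\ell}z_i+\sum_{i=1}^{\ell-1}w_i\Big)-e^{z_1}-\sum_{i=1}^{\ell-1}\big(e^{w_i-z_i}+e^{z_{i+1}-w_i}+e^{x_i-z_i}+e^{z_{i+1}-x_i}\big)-e^{x_\ell-z_\ell}\Big\}.$$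
   Formalization: The printed identity fails (ℓ=1, λ=0, γ=−i: left side finite and positive, right side has a pole); proved instead with the kernel at −γ and an extra factor Γ(−2ıγ) on the right, for ℓ≥1 and |Im λ_i| < Im γ, the region where the integrals converge. *)

theory Defs
  imports "HOL-Analysis.Analysis"
begin

text \<open>
  The rank varies in the recursion for the Whittaker functions, so \<open>\<real>\<^sup>n\<close> is rendered by functions
  \<open>nat \<Rightarrow> real\<close> of which only the coordinates \<open>1, \<dots>, n\<close> matter, with Lebesgue measure the product
  measure below.  For \<open>n = 0\<close> it is a point mass, so integrating over \<open>\<real>\<^sup>0\<close> is evaluation.
\<close>

abbreviation lebR :: "nat \<Rightarrow> (nat \<Rightarrow> real) measure" where
  "lebR n \<equiv> Pi\<^sub>M {1..n} (\<lambda>_. lborel)"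

text \<open>Kernel of the Baxter operator of \<open>so(2 l + 1)\<close>.  The integral over \<open>z (l + 1)\<close> converges
  absolutely precisely when \<open>Im \<gamma> < 0\<close>.\<close>

definition baxter_kernel ::
    "nat \<Rightarrow> (nat \<Rightarrow> real) \<Rightarrow> (nat \<Rightarrow> real) \<Rightarrow> complex \<Rightarrow> complex" where
  "baxter_kernel l y x \<gamma> =
    (\<integral>z. exp (- \<i> * \<gamma> * complex_of_real
              ((\<Sum>i=1..l. y i) - 2 * (\<Sum>i=1..l+1. z i) + (\<Sum>i=1..l. x i)))
        * complex_of_real (exp (- exp (z 1)
            - (\<Sum>i=1..l. exp (y i - z i) + exp (z (i+1) - y i)
                       + exp (x i - z i) + exp (z (i+1) - x i))))
     \<partial>lebR (l+1))"

text \<open>Kernel of the recursive operator from \<open>so(2 l - 1)\<close> to \<open>so(2 l + 1)\<close>, used for \<open>l \<ge> 1\<close>.\<close>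

definition recursive_kernel ::
    "nat \<Rightarrow> (nat \<Rightarrow> real) \<Rightarrow> (nat \<Rightarrow> real) \<Rightarrow> complex \<Rightarrow> complex" where
  "recursive_kernel l x w \<mu> =
    (\<integral>z. exp (- \<i> * \<mu> * complex_of_real
              ((\<Sum>i=1..l. x i) - 2 * (\<Sum>i=1..l. z i) + (\<Sum>i=1..l-1. w i)))
        * complex_of_real (exp (- exp (z 1)
            - (\<Sum>i=1..l-1. exp (w i - z i) + exp (z (i+1) - w i)
                         + exp (x i - z i) + exp (z (i+1) - x i))
            - exp (x l - z l)))
     \<partial>lebR l)"

primrec whittaker :: "nat \<Rightarrow> (nat \<Rightarrow> complex) \<Rightarrow> (nat \<Rightarrow> real) \<Rightarrow> complex" where
  "whittaker 0 lam x = 1"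
| "whittaker (Suc l) lam x =
    (\<integral>w. recursive_kernel (Suc l) x w (lam (Suc l)) * whittaker l lam w \<partial>lebR l)"

end

theory Submission
  imports Defs
begin

text \<open>
  Put \<open>a = - \<i> \<gamma>\<close> and \<open>b = \<i> \<lambda>\<^sub>l\<close>. In every kernel the integration variables \<open>z\<^sub>i\<close> are decoupled
  once the outer variables are fixed, so a kernel is an exponential times a product of
  one-dimensional integrals \<open>M s A B = \<integral> exp (s t - A e\<^sup>t - B e\<^sup>-\<^sup>t) dt\<close> (Macdonald functions). Only
  two facts about \<open>M\<close> matter: the reflection \<open>t \<mapsto> ln (B / A) - t\<close> gives \<open>M s A B = (B / A)\<^sup>s M (-
  s) A B\<close>, and a translation gives \<open>M s A 0 = A\<^sup>-\<^sup>s \<Gamma> s\<close>.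

  Along a chain the coefficients \<open>A\<close> and \<open>B\<close> of neighbouring sites differ by an exponential of the
  outer variables, \<open>e\<^sup>-\<^sup>y + e\<^sup>-\<^sup>x = (e\<^sup>y + e\<^sup>x) e\<^sup>-\<^sup>y\<^sup>-\<^sup>x\<close>; hence reflecting all sites at once produces a
  telescoping product of the factors \<open>(B / A)\<^sup>s\<close>, and what survives is an explicit exponential.
  Applied to the Baxter kernel at \<open>- \<gamma>\<close> this shows that it is \<open>\<Gamma> (2 a)\<close> times a kernel
  \<open>toda_kernel l l\<close> with one integration variable fewer, which has the same shape as the recursive
  kernel \<open>toda_kernel l (l - 1)\<close>.

  The heart of the matter is then the intertwining relation \<open>toda_kernel_exchange\<close>: passing the
  Baxter kernel of rank \<open>n + 1\<close> through the recursive kernel turns it into the Baxter kernel of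
  rank \<open>n\<close> and costs \<open>\<Gamma> (a - b) \<Gamma> (a + b)\<close>. After both kernels are written out, with integration
  variables \<open>z\<close> and \<open>u\<close>, one reflects the variables \<open>x\<close> linking them for fixed \<open>(z, u)\<close>, then the
  pairs \<open>(z\<^sub>i, u\<^sub>i)\<close> for fixed \<open>x\<close>, then \<open>x\<close> again. The outermost variables \<open>x\<close> and \<open>u\<close> feel no
  barrier on one side; they yield the two Gamma factors. The first reflection leaves the factor
  \<open>(e\<^sup>z + e\<^sup>u)\<^sup>b\<^sup>-\<^sup>a\<close> at the first site, which couples \<open>z\<^sub>1\<close> and \<open>u\<^sub>1\<close>; in the coordinates \<open>ln (e\<^sup>z + e\<^sup>u)\<close>
  and \<open>u - z\<close> the coupled integral is again a Macdonald integral in \<open>u - z\<close>, so it obeys the same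
  reflection law (\<open>integral_boundary_weight_reflect\<close>).

  The theorem follows by induction on the rank, which accumulates the Gamma factors. All the
  exchanges of integrals rest on absolute convergence. Replacing each parameter by its real part
  replaces an integrand by its absolute value, so the identities themselves, read for real
  parameters, transport finiteness from the last integral of a chain of identities to the first;
  for the last one it comes from the recursive kernel, which decays faster than any exponential.
\<close>

section \<open>Macdonald integrals\<close>

definition macdonald_weight :: "complex \<Rightarrow> real \<Rightarrow> real \<Rightarrow> real \<Rightarrow> complex" where
  "macdonald_weight s A B t = exp (s * complex_of_real t
      - complex_of_real (A * exp t + B * exp (- t)))"

text \<open>
  For positive \<open>A\<close> and \<open>B\<close> this is \<open>2 (B / A)\<^sup>s\<^sup>/\<^sup>2 K\<^sub>s (2 \<surd>(A B))\<close>, with \<open>K\<^sub>s\<close> the Macdonald function;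
  the integral form also covers \<open>B = 0\<close>, where it is a Gamma function.
\<close>
definition macdonald :: "complex \<Rightarrow> real \<Rightarrow> real \<Rightarrow> complex" where
  "macdonald s A B = (\<integral>t. macdonald_weight s A B t \<partial>lborel)"

lemma norm_macdonald_weight: "norm (macdonald_weight s A B t)
    = exp (Re s * t - (A * exp t + B * exp (- t)))"
  by (simp add: macdonald_weight_def norm_exp_eq_Re)

lemma macdonald_weight_of_real: "macdonald_weight (complex_of_real r) A B t
    = complex_of_real (exp (r * t - (A * exp t + B * exp (- t))))"
  by (simp add: macdonald_weight_def exp_of_real flip: of_real_mult of_real_diff of_real_add)

lemma measurable_macdonald_weight [measurable (raw)]:
  assumes "f \<in> borel_measurable M" "g \<in> borel_measurable M" "h \<in> borel_measurable M"
  shows "(\<lambda>x. macdonald_weight s (f x) (g x) (h x)) \<in> borel_measurable M"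
  unfolding macdonald_weight_def using assms by measurable

lemma measurable_macdonald [measurable (raw)]:
  assumes [measurable]: "f \<in> borel_measurable M" "g \<in> borel_measurable M"
  shows "(\<lambda>x. macdonald s (f x) (g x)) \<in> borel_measurable M"
  unfolding macdonald_def by measurable

text \<open>
  The substitution \<open>t \<mapsto> e\<^sup>t\<close> in Euler's integral.
\<close>
lemma macdonald_eq_Gamma:
  assumes "Re s > 0"
  shows "integrable lborel (macdonald_weight s 1 0)" and "macdonald s 1 0 = Gamma s"
proof -
  let ?f = "\<lambda>t::real. complex_of_real t powr (s - 1) / of_real (exp t)"
  have range: "range (exp :: real \<Rightarrow> real) = {0<..}"
    by (auto simp: image_def intro: exp_ln[symmetric])
  have eq: "\<bar>exp x\<bar> *\<^sub>R ?f (exp x) = macdonald_weight s 1 0 x" for x :: real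
  proof -
    have "\<bar>exp x\<bar> *\<^sub>R ?f (exp x)
        = exp (complex_of_real x) * (exp ((s - 1)
            * complex_of_real x) / exp (complex_of_real (exp x)))"
      by (simp add: scaleR_conv_of_real powr_def exp_of_real Ln_of_real)
    also have "\<dots> = exp (complex_of_real x + (s - 1) * complex_of_real x - complex_of_real (exp x))"
      by (simp add: exp_add exp_diff)
    also have "\<dots> = macdonald_weight s 1 0 x" by (simp add: macdonald_weight_def algebra_simps)
    finally show ?thesis .
  qed
  have "(\<lambda>x. \<bar>exp x\<bar> *\<^sub>R ?f (exp x)) absolutely_integrable_on UNIV \<and>
        integral UNIV (\<lambda>x. \<bar>exp x\<bar> *\<^sub>R ?f (exp x)) = Gamma s"
    using absolutely_integrable_Gamma_integral'[OF assms] Gamma_integral_complex'[OF assms]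
    by (subst has_absolute_integral_change_of_variables_real)
       (auto simp: range intro: injI)
  then have 1: "macdonald_weight s 1 0 absolutely_integrable_on UNIV"
      "integral UNIV (macdonald_weight s 1 0) = Gamma s"
    unfolding eq by auto
  show *: "integrable lborel (macdonald_weight s 1 0)"
    using 1(1) by (simp add: set_integrable_def integrable_completion)
  show "macdonald s 1 0 = Gamma s"
    using 1(2) has_integral_integral_lborel[OF *] unfolding macdonald_def
        by (simp add: integral_unique)
qed

lemma integrable_exp_minus_abs: "integrable lborel (\<lambda>t::real. exp (- \<bar>t\<bar>))"
proof -
  have 1: "integrable lborel (\<lambda>t. norm (macdonald_weight 1 1 0 t))"
    using macdonald_eq_Gamma(1)[of 1] by simp
  have 2: "integrable lborel (\<lambda>t. norm (macdonald_weight 1 1 0 (0 + (-1) * t)))"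
    by (rule lborel_integrable_real_affine[OF 1]) simp
  \<comment> \<open>On the negative half-line \<open>exp (t - e\<^sup>t)\<close> is at least \<open>e\<^sup>t\<^sup>-\<^sup>1\<close>; its mirror image serves the
      positive one.\<close>
  have "integrable lborel (\<lambda>t. exp 1 * (norm (macdonald_weight 1 1 0 t)
      + norm (macdonald_weight 1 1 0 (0 + (-1) * t))))"
    using 1 2 by simp
  then show ?thesis
  proof (rule Bochner_Integration.integrable_bound, goal_cases)
    case 2
    have "exp (- \<bar>t\<bar>) \<le> exp 1 * (norm (macdonald_weight 1 1 0 t)
        + norm (macdonald_weight 1 1 0 (- t)))" for t
    proof -
      have *: "exp (- \<bar>t\<bar>) \<le> exp 1 * norm (macdonald_weight 1 1 0 (- \<bar>t\<bar>))"
        by (simp add: norm_macdonald_weight flip: exp_add)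
      show ?thesis
      proof (cases "t \<ge> 0")
        case True
        then show ?thesis using * by (simp add: distrib_left add_increasing)
      next
        case False
        then show ?thesis using * by (simp add: distrib_left add_increasing2)
      qed
    qed
    then show ?case by simp
  qed simp
qed

text \<open>
  Maximising \<open>k ln u - u\<close> over \<open>u\<close> gives the constant: the maximum is at \<open>u = k\<close>.
\<close>
lemma exp_minus_le_power:
  fixes u k :: real
  assumes "u > 0" "k \<ge> 0"
  shows "exp (- u) \<le> exp (k * ln k - k) * exp (- k * ln u)"
proof (cases "k = 0")
  case False
  then have "ln (u / k) \<le> u / k - 1" using assms by (intro ln_le_minus_one) auto
  then have "k * (ln u - ln k) \<le> k * (u / k - 1)"
    using assms False by (intro mult_left_mono) (auto simp: ln_div)
  then have "k * ln u - k * ln k \<le> u - k" using False by (simp add: algebra_simps)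
  then show ?thesis by (simp flip: exp_add)
qed (use assms in auto)

text \<open>
  Each of the factors \<open>exp (- A e\<^sup>t)\<close> and \<open>exp (- B e\<^sup>-\<^sup>t)\<close> may be traded for a power. Trading in the
  power \<open>k + j\<close> where the factor is small and the power \<open>k\<close> where it is not leaves \<open>e\<^sup>-\<^sup>\<bar>\<^sup>t\<^sup>\<bar>\<close>, and
  still \<open>k\<close> powers of decay in both \<open>A\<close> and \<open>B\<close>.
\<close>
lemma norm_macdonald_weight_bound:
  fixes A B k j :: real
  assumes "A > 0" "B > 0" "k \<ge> 0" "j \<ge> \<bar>Re s\<bar> + 1"
  shows "norm (macdonald_weight s A B t) \<le> exp (k * ln k - k) * exp ((k + j) * ln (k + j) - (k + j))
      *
    (exp (- (k + j) * ln A - k * ln B) + exp (- k * ln A - (k + j) * ln B)) * exp (- \<bar>t\<bar>)"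
proof -
  let ?c = "\<lambda>k::real. exp (k * ln k - k)"
  have a: "exp (- (A * exp t)) \<le> ?c m * exp (- m * (ln A + t))" if "m \<ge> 0" for m
    using exp_minus_le_power[of "A * exp t" m] assms that by (simp add: ln_mult)
  have b: "exp (- (B * exp (- t))) \<le> ?c m * exp (- m * (ln B - t))" if "m \<ge> 0" for m
    using exp_minus_le_power[of "B * exp (- t)" m] assms that by (simp add: ln_mult)
  have eq: "norm (macdonald_weight s A B t) = exp (Re s * t)
      * (exp (- (A * exp t)) * exp (- (B * exp (- t))))"
    by (simp add: norm_macdonald_weight flip: exp_add)
  show ?thesis
  proof (cases "t \<ge> 0")
    case True
    have "norm (macdonald_weight s A B t) \<le> exp (Re s * t)
        * ((?c (k + j) * exp (- (k + j) * (ln A + t))) * (?c k * exp (- k * (ln B - t))))"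
      unfolding eq using assms by (intro mult_left_mono mult_mono a b) auto
    also have "\<dots> = ?c k * ?c (k + j) * (exp (- (k + j) * ln A - k * ln B) * exp ((Re s - j) * t))"
      by (simp add: algebra_simps flip: exp_add)
    also have "\<dots> \<le> ?c k * ?c (k + j) * (exp (- (k + j) * ln A - k * ln B) * exp (- \<bar>t\<bar>))"
    proof -
      have "(Re s - j) * t \<le> (-1) * t" using True assms by (intro mult_right_mono) auto
      then show ?thesis using True by (intro mult_left_mono) auto
    qed
    also have "\<dots> \<le> ?c k * ?c (k + j) * ((exp (- (k + j) * ln A - k * ln B)
        + exp (- k * ln A - (k + j) * ln B)) * exp (- \<bar>t\<bar>))"
      by (intro mult_left_mono mult_right_mono) auto
    finally show ?thesis by (simp only: mult.assoc)
  next
    case False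
    have "norm (macdonald_weight s A B t) \<le> exp (Re s * t)
        * ((?c k * exp (- k * (ln A + t))) * (?c (k + j) * exp (- (k + j) * (ln B - t))))"
      unfolding eq using assms by (intro mult_left_mono mult_mono a b) auto
    also have "\<dots> = ?c k * ?c (k + j) * (exp (- k * ln A - (k + j) * ln B)
        * exp ((- Re s - j) * (- t)))"
      by (simp add: algebra_simps flip: exp_add)
    also have "\<dots> \<le> ?c k * ?c (k + j) * (exp (- k * ln A - (k + j) * ln B) * exp (- \<bar>t\<bar>))"
    proof -
      have "(- Re s - j) * (- t) \<le> (-1) * (- t)" using False assms by (intro mult_right_mono) auto
      then show ?thesis using False by (intro mult_left_mono) auto
    qed
    also have "\<dots> \<le> ?c k * ?c (k + j) * ((exp (- (k + j) * ln A - k * ln B)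
        + exp (- k * ln A - (k + j) * ln B)) * exp (- \<bar>t\<bar>))"
      by (intro mult_left_mono mult_right_mono) auto
    finally show ?thesis by (simp only: mult.assoc)
  qed
qed

lemma macdonald_weight_shift: "macdonald_weight s A B (c + t) = exp (s * complex_of_real c)
    * macdonald_weight s (A * exp c) (B * exp (- c)) t"
  by (simp add: macdonald_weight_def exp_add[symmetric] algebra_simps)

lemma integrable_macdonald_weight:
  assumes "A > 0" "B > 0 \<or> B = 0 \<and> Re s > 0"
  shows "integrable lborel (macdonald_weight s A B)"
proof (cases "B > 0")
  case True
  define j where "j = \<bar>Re s\<bar> + 1"
  define C where "C = exp ((0 + j) * ln (0 + j) - (0 + j))
      * (exp (- (0 + j) * ln A) + exp (- (0 + j) * ln B))"
  show ?thesis
  proof (rule Bochner_Integration.integrable_bound)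
    show "integrable lborel (\<lambda>t. C * exp (- \<bar>t\<bar>))" using integrable_exp_minus_abs by simp
    show "AE t in lborel. norm (macdonald_weight s A B t) \<le> norm (C * exp (- \<bar>t\<bar>))"
    proof (rule AE_I2)
      fix t
      have "norm (macdonald_weight s A B t) \<le> C * exp (- \<bar>t\<bar>)"
        using norm_macdonald_weight_bound[of A B 0 s j t] assms(1) True
        by (simp add: j_def C_def algebra_simps)
      then show "norm (macdonald_weight s A B t) \<le> norm (C * exp (- \<bar>t\<bar>))"
        by (rule order_trans) simp
    qed
  qed simp
next
  case False
  then have *: "B = 0" "Re s > 0" using assms(2) by auto
  have "integrable lborel (\<lambda>t. exp (- s * complex_of_real (ln A))
      * macdonald_weight s 1 0 (ln A + 1 * t))"
    by (intro integrable_mult_right lborel_integrable_real_affine macdonald_eq_Gamma *) simp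
  moreover have "exp (- s * complex_of_real (ln A)) * macdonald_weight s 1 0 (ln A + 1 * t)
      = macdonald_weight s A B t" for t
    using assms(1) by (simp add: macdonald_weight_shift * exp_add flip: exp_add)
  ultimately show ?thesis by simp
qed

lemma macdonald_reflect:
  assumes "A > 0" "B > 0"
  shows "macdonald s A B = exp (s * complex_of_real (ln B - ln A)) * macdonald (- s) A B"
proof -
  have "macdonald s A B = (\<integral>t. macdonald_weight s A B ((ln B - ln A) + (-1) * t) \<partial>lborel)"
    unfolding macdonald_def by (subst lborel_integral_real_affine[of "-1" _ "ln B - ln A"]) auto
  also have "(\<lambda>t. macdonald_weight s A B ((ln B - ln A) + (-1) * t))
      = (\<lambda>t. exp (s * complex_of_real (ln B - ln A)) * macdonald_weight (- s) A B t)"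
    using assms unfolding macdonald_weight_shift
        by (simp add: macdonald_weight_def exp_diff add.commute)
  finally show ?thesis by (simp add: macdonald_def)
qed

lemma macdonald_zero:
  assumes "A > 0" "Re s > 0"
  shows "macdonald s A 0 = exp (- s * complex_of_real (ln A)) * Gamma s"
proof -
  have "macdonald s A 0 = (\<integral>t. macdonald_weight s A 0 (- ln A + 1 * t) \<partial>lborel)"
    unfolding macdonald_def by (subst lborel_integral_real_affine[of 1 _ "- ln A"]) auto
  also have "(\<lambda>t. macdonald_weight s A 0 (- ln A + 1 * t))
      = (\<lambda>t. exp (- s * complex_of_real (ln A)) * macdonald_weight s 1 0 t)"
    using assms unfolding macdonald_weight_shift by (simp add: exp_minus)
  finally show ?thesis using macdonald_eq_Gamma(2)[OF assms(2)] by (simp add: macdonald_def)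
qed

lemma of_real_norm_macdonald_weight: "complex_of_real (norm (macdonald_weight s A B t))
    = macdonald_weight (complex_of_real (Re s)) A B t"
  by (simp add: norm_macdonald_weight macdonald_weight_of_real)

lemma of_real_integral_norm_macdonald_weight:
  "complex_of_real (\<integral>t. norm (macdonald_weight s A B t) \<partial>lborel)
      = macdonald (complex_of_real (Re s)) A B"
  unfolding macdonald_def of_real_norm_macdonald_weight[symmetric] by simp

text \<open>
  For a real parameter the integrand is positive, so a Macdonald integral equals its own absolute
  value. Statements of this form let an identity for all parameters be read as an identity between
  integrals of absolute values.
\<close>
lemma norm_macdonald_of_real: "complex_of_real (norm (macdonald (complex_of_real r) A B))
    = macdonald (complex_of_real r) A B"
proof -
  have "macdonald (complex_of_real r) A B = complex_of_real
      (\<integral>t. norm (macdonald_weight (complex_of_real r) A B t) \<partial>lborel)"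
    by (simp add: of_real_integral_norm_macdonald_weight)
  moreover have "(\<integral>t. norm (macdonald_weight (complex_of_real r) A B t) \<partial>lborel) \<ge> 0" by simp
  ultimately show ?thesis by simp
qed

lemma norm_macdonald_le_Re: "norm (macdonald s A B) \<le> norm (macdonald (complex_of_real (Re s)) A B)"
proof -
  have "norm (macdonald s A B) \<le> (\<integral>t. norm (macdonald_weight s A B t) \<partial>lborel)"
    unfolding macdonald_def by (rule integral_norm_bound)
  also have "\<dots> = norm (complex_of_real (\<integral>t. norm (macdonald_weight s A B t) \<partial>lborel))" by simp
  finally show ?thesis unfolding of_real_integral_norm_macdonald_weight .
qed

lemma norm_macdonald_bound:
  fixes k j :: real
  assumes "k \<ge> 0" "j \<ge> \<bar>Re s\<bar> + 1"
  shows "\<exists>C\<ge>0. \<forall>A>0. \<forall>B>0. norm (macdonald s A B)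
     \<le> C * (exp (- (k + j) * ln A - k * ln B) + exp (- k * ln A - (k + j) * ln B))"
proof -
  define c where "c = exp (k * ln k - k) * exp ((k + j) * ln (k + j) - (k + j))"
  define C where "C = c * (\<integral>t. exp (- \<bar>t::real\<bar>) \<partial>lborel)"
  have "norm (macdonald s A B) \<le> C * (exp (- (k + j) * ln A - k * ln B)
      + exp (- k * ln A - (k + j) * ln B))"
    (is "_ \<le> C * ?e") if "A > 0" "B > 0" for A B
  proof -
    have "norm (macdonald s A B) \<le> (\<integral>t. norm (macdonald_weight s A B t) \<partial>lborel)"
      unfolding macdonald_def by (rule integral_norm_bound)
    also have "\<dots> \<le> (\<integral>t. c * ?e * exp (- \<bar>t\<bar>) \<partial>lborel)"
    proof (rule integral_mono)
      show "integrable lborel (\<lambda>t. norm (macdonald_weight s A B t))"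
          using integrable_macdonald_weight that by auto
      show "integrable lborel (\<lambda>t. c * ?e * exp (- \<bar>t\<bar>))" using integrable_exp_minus_abs by simp
      show "norm (macdonald_weight s A B t) \<le> c * ?e * exp (- \<bar>t\<bar>)" for t
        unfolding c_def by (rule norm_macdonald_weight_bound) (use assms that in auto)
    qed
    also have "\<dots> = C * ?e" by (simp add: C_def)
    finally show ?thesis .
  qed
  moreover have "C \<ge> 0" by (simp add: C_def c_def)
  ultimately show ?thesis by blast
qed

section \<open>Product measures and Fubini\<close>

text \<open>
  Pairs \<open>(z\<^sub>i, u\<^sub>i)\<close> indexed by sites, since the boundary factor couples \<open>z\<^sub>1\<close> with \<open>u\<^sub>1\<close> but no two
  different sites.
\<close>
abbreviation lebR2 :: "nat \<Rightarrow> (nat \<Rightarrow> real \<times> real) measure" where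
  "lebR2 n \<equiv> Pi\<^sub>M {1..n} (\<lambda>_. lborel \<Otimes>\<^sub>M lborel)"

interpretation lborel_sites: product_sigma_finite "\<lambda>_::nat. lborel :: real measure" ..

lemma sigma_finite_lborel2: "sigma_finite_measure (lborel \<Otimes>\<^sub>M lborel :: (real \<times> real) measure)"
  unfolding lborel_prod by (rule lborel.sigma_finite_measure_axioms)

interpretation lborel2_sites: product_sigma_finite
    "\<lambda>_::nat. lborel \<Otimes>\<^sub>M lborel :: (real \<times> real) measure"
  by (simp add: product_sigma_finite_def sigma_finite_lborel2)

lemma sigma_finite_lebR: "sigma_finite_measure (lebR n)"
  by (rule lborel_sites.sigma_finite) simp

lemma sigma_finite_lebR2: "sigma_finite_measure (lebR2 n)"
  by (rule lborel2_sites.sigma_finite) simp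

lemma
  fixes f :: "'a \<Rightarrow> complex" and g :: "'b \<Rightarrow> complex"
  assumes "sigma_finite_measure M" "sigma_finite_measure N" "integrable M f" "integrable N g"
  shows integrable_pair_mult: "integrable (M \<Otimes>\<^sub>M N) (\<lambda>v. f (fst v) * g (snd v))"
    and integral_pair_mult: "(\<integral>v. f (fst v) * g (snd v) \<partial>(M \<Otimes>\<^sub>M N)) = (\<integral>z. f z \<partial>M) * (\<integral>u. g u \<partial>N)"
proof -
  interpret pair_sigma_finite M N using assms(1,2) by (simp add: pair_sigma_finite_def)
  note [measurable] = borel_measurable_integrable[OF assms(3)]
      borel_measurable_integrable[OF assms(4)]
  show *: "integrable (M \<Otimes>\<^sub>M N) (\<lambda>v. f (fst v) * g (snd v))"
    by (rule Fubini_integrable) (use assms in \<open>auto simp: norm_mult\<close>)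
  show "(\<integral>v. f (fst v) * g (snd v) \<partial>(M \<Otimes>\<^sub>M N)) = (\<integral>z. f z \<partial>M) * (\<integral>u. g u \<partial>N)"
    using integral_fst'[OF *] by simp
qed

text \<open>
  A double integral may be rewritten in its inner variable alone, even into one over another
  space. The order of the factors in the second product is chosen so that such steps can be
  chained while alternating the inner variable.
\<close>
lemma fubini_integral_eq:
  fixes f :: "'a \<Rightarrow> 'b \<Rightarrow> complex" and g :: "'a \<Rightarrow> 'c \<Rightarrow> complex"
  assumes M: "sigma_finite_measure M" and N: "sigma_finite_measure N" and N':
      "sigma_finite_measure N'"
    and f: "integrable (M \<Otimes>\<^sub>M N) (\<lambda>v. f (fst v) (snd v))"
    and g: "integrable (N' \<Otimes>\<^sub>M M) (\<lambda>v. g (snd v) (fst v))"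
    and eq: "\<And>x. x \<in> space M \<Longrightarrow> (\<integral>y. f x y \<partial>N) = c * (\<integral>y. g x y \<partial>N')"
  shows "(\<integral>v. f (fst v) (snd v) \<partial>(M \<Otimes>\<^sub>M N)) = c * (\<integral>v. g (snd v) (fst v) \<partial>(N' \<Otimes>\<^sub>M M))"
proof -
  interpret MN: pair_sigma_finite M N using M N by (simp add: pair_sigma_finite_def)
  interpret NM: pair_sigma_finite N' M using M N' by (simp add: pair_sigma_finite_def)
  have "(\<integral>v. f (fst v) (snd v) \<partial>(M \<Otimes>\<^sub>M N)) = (\<integral>x. (\<integral>y. f x y \<partial>N) \<partial>M)"
    using MN.integral_fst'[OF f] by simp
  also have "\<dots> = (\<integral>x. c * (\<integral>y. g x y \<partial>N') \<partial>M)"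
    by (intro Bochner_Integration.integral_cong refl eq)
  also have "\<dots> = c * (\<integral>x. (\<integral>y. g x y \<partial>N') \<partial>M)" by simp
  also have "(\<integral>x. (\<integral>y. g x y \<partial>N') \<partial>M) = (\<integral>v. g (snd v) (fst v) \<partial>(N' \<Otimes>\<^sub>M M))"
    using NM.integral_snd[of "\<lambda>y x. g x y"] g by (simp add: case_prod_beta')
  finally show ?thesis .
qed

text \<open>
  Integrability travels against the direction of the equation: from the rewritten integrand to the
  original one.
\<close>
lemma fubini_integrable_transfer:
  fixes f :: "'a \<Rightarrow> 'b \<Rightarrow> complex" and g :: "'a \<Rightarrow> 'c \<Rightarrow> complex"
  assumes M: "sigma_finite_measure M" and N: "sigma_finite_measure N" and N':
      "sigma_finite_measure N'"
    and f: "(\<lambda>v. f (fst v) (snd v)) \<in> borel_measurable (M \<Otimes>\<^sub>M N)"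
    and g: "integrable (N' \<Otimes>\<^sub>M M) (\<lambda>v. g (snd v) (fst v))"
    and int: "\<And>x. x \<in> space M \<Longrightarrow> integrable N (f x)"
    and le: "\<And>x. x \<in> space M \<Longrightarrow> (\<integral>y. norm (f x y) \<partial>N) \<le> K * (\<integral>y. norm (g x y) \<partial>N')"
  shows "integrable (M \<Otimes>\<^sub>M N) (\<lambda>v. f (fst v) (snd v))"
proof -
  interpret MN: pair_sigma_finite M N using M N by (simp add: pair_sigma_finite_def)
  interpret NM: pair_sigma_finite N' M using M N' by (simp add: pair_sigma_finite_def)
  note f[measurable]
  have [measurable]: "(\<lambda>(x, y). f x y) \<in> borel_measurable (M \<Otimes>\<^sub>M N)"
    using f by (simp add: case_prod_beta')
  have g': "integrable (N' \<Otimes>\<^sub>M M) (\<lambda>(y, x). norm (g x y))"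
    using integrable_norm[OF g] by (simp add: case_prod_beta')
  show ?thesis
  proof (rule MN.Fubini_integrable)
    show "integrable M (\<lambda>x. \<integral>y. norm (f (fst (x, y)) (snd (x, y))) \<partial>N)"
    proof (rule Bochner_Integration.integrable_bound)
      show "integrable M (\<lambda>x. K * (\<integral>y. norm (g x y) \<partial>N'))"
        using NM.integrable_snd[OF g'] by simp
      show "AE x in M. norm (\<integral>y. norm (f (fst (x, y)) (snd (x, y))) \<partial>N)
          \<le> norm (K * (\<integral>y. norm (g x y) \<partial>N'))"
        using le by (intro AE_I2) (auto intro: order_trans[OF _ abs_ge_self])
    qed simp
  qed (use int in auto)
qed

text \<open>
  The two coordinates are also exchanged, so that applying this twice performs shears along both
  axes.
\<close>
lemma
  fixes f :: "real \<Rightarrow> real \<Rightarrow> complex" and h :: "real \<Rightarrow> real"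
  assumes [measurable]: "h \<in> borel_measurable borel"
    and f: "integrable (lborel \<Otimes>\<^sub>M lborel) (\<lambda>v. f (fst v) (snd v))"
  shows integrable_shear: "integrable (lborel \<Otimes>\<^sub>M lborel) (\<lambda>v. f (snd v) (fst v + h (snd v)))"
    and integral_shear: "(\<integral>v. f (snd v) (fst v + h (snd v)) \<partial>(lborel \<Otimes>\<^sub>M lborel))
      = (\<integral>v. f (fst v) (snd v) \<partial>(lborel \<Otimes>\<^sub>M lborel))"
proof -
  have [measurable]: "(\<lambda>v. f (fst v) (snd v)) \<in> borel_measurable (lborel \<Otimes>\<^sub>M lborel)"
    using f by (rule borel_measurable_integrable)
  then have [measurable]: "(\<lambda>(x, y). f x y) \<in> borel_measurable (borel \<Otimes>\<^sub>M borel)"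
    by (simp add: case_prod_beta' cong: measurable_cong_sets)
  have shift: "(\<integral>y. k (y + c) \<partial>lborel) = (\<integral>y. k y \<partial>lborel)" for k ::
      "real \<Rightarrow> 'z::{banach,second_countable_topology}" and c
    using lborel_integral_real_affine[of 1 k c] by (simp add: add.commute)
  have ishift: "integrable lborel (\<lambda>y. k (y + c)) \<longleftrightarrow> integrable lborel k" for k :: "real \<Rightarrow> complex"
      and c
    using lborel_integrable_real_affine_iff[of 1 k c] by (simp add: add.commute)
  have 1: "integrable (lborel \<Otimes>\<^sub>M lborel) (\<lambda>v. f (fst v) (snd v + h (fst v)))"
  proof (rule lborel_pair.Fubini_integrable)
    show "AE x in lborel. integrable lborel (\<lambda>y. f (fst (x, y)) (snd (x, y) + h (fst (x, y))))"
      using lborel_pair.AE_integrable_fst'[OF f] by (simp add: ishift)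
    show "integrable lborel (\<lambda>x. \<integral>y. norm (f (fst (x, y)) (snd (x, y) + h (fst (x, y)))) \<partial>lborel)"
      using lborel_pair.integrable_fst'[OF integrable_norm[OF f]]
      by (simp add: shift[of "\<lambda>y. norm (f _ y)"])
  qed measurable
  show "integrable (lborel \<Otimes>\<^sub>M lborel) (\<lambda>v. f (snd v) (fst v + h (snd v)))"
    using lborel_pair.integrable_product_swap[OF 1] by (simp add: case_prod_beta')
  have "(\<integral>v. f (snd v) (fst v + h (snd v)) \<partial>(lborel \<Otimes>\<^sub>M lborel))
     = (\<integral>v. f (fst v) (snd v + h (fst v)) \<partial>(lborel \<Otimes>\<^sub>M lborel))"
    using lborel_pair.integral_product_swap[OF borel_measurable_integrable[OF 1]]
        by (simp add: case_prod_beta')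
  also have "\<dots> = (\<integral>x. (\<integral>y. f x (y + h x) \<partial>lborel) \<partial>lborel)"
    using lborel_pair.integral_fst'[OF 1] by simp
  also have "\<dots> = (\<integral>x. (\<integral>y. f x y \<partial>lborel) \<partial>lborel)"
    by (simp add: shift)
  also have "\<dots> = (\<integral>v. f (fst v) (snd v) \<partial>(lborel \<Otimes>\<^sub>M lborel))"
    using lborel_pair.integral_fst'[OF f] by simp
  finally show "(\<integral>v. f (snd v) (fst v + h (snd v)) \<partial>(lborel \<Otimes>\<^sub>M lborel))
      = (\<integral>v. f (fst v) (snd v) \<partial>(lborel \<Otimes>\<^sub>M lborel))" .
qed

section \<open>The coupled first site\<close>

definition log_sum_exp :: "real \<Rightarrow> real \<Rightarrow> real" where
  "log_sum_exp z u = ln (exp z + exp u)"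

lemma measurable_log_sum_exp [measurable (raw)]:
  assumes "f \<in> borel_measurable M" "g \<in> borel_measurable M"
  shows "(\<lambda>x. log_sum_exp (f x) (g x)) \<in> borel_measurable M"
  unfolding log_sum_exp_def using assms by measurable

lemma exp_log_sum_exp: "exp (log_sum_exp z u) = exp z + exp u"
  by (simp add: log_sum_exp_def add_pos_pos)

text \<open>
  The integrand at the first site after the first reflection: two Macdonald integrands coupled by
  \<open>(e\<^sup>z + e\<^sup>u)\<^sup>-\<^sup>s\<close>.
\<close>
definition boundary_weight :: "complex \<Rightarrow> complex \<Rightarrow> real \<Rightarrow> real \<Rightarrow> real \<times> real \<Rightarrow> complex" where
  "boundary_weight s p E F v = exp (- s * complex_of_real (log_sum_exp (fst v) (snd v)))
      * (macdonald_weight (- p) 1 E (fst v) * macdonald_weight p 1 F (snd v))"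

lemma integrable_boundary_weight:
  assumes "Re s > 0" "E > 0" "F > 0 \<or> F = 0 \<and> Re p > 0"
  shows "integrable (lborel \<Otimes>\<^sub>M lborel) (boundary_weight s p E F)"
proof (rule Bochner_Integration.integrable_bound)
  show "integrable (lborel \<Otimes>\<^sub>M lborel) (\<lambda>v. macdonald_weight (- s - p) 1 E (fst v)
      * macdonald_weight p 1 F (snd v))"
    using assms by (intro integrable_pair_mult integrable_macdonald_weight)
        (auto intro: lborel.sigma_finite_measure_axioms)
  show "boundary_weight s p E F \<in> borel_measurable (lborel \<Otimes>\<^sub>M lborel)"
    unfolding boundary_weight_def by measurable
  show "AE v in lborel \<Otimes>\<^sub>M lborel. norm (boundary_weight s p E F v)
      \<le> norm (macdonald_weight (- s - p) 1 E (fst v) * macdonald_weight p 1 F (snd v))"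
  proof (rule AE_I2)
    fix v :: "real \<times> real"
    have "fst v \<le> log_sum_exp (fst v) (snd v)"
      unfolding log_sum_exp_def by (subst ln_ge_iff) (auto simp: add_pos_pos)
    then have "Re s * fst v \<le> Re s * log_sum_exp (fst v) (snd v)" using assms
        by (intro mult_left_mono) auto
    then show "norm (boundary_weight s p E F v)
        \<le> norm (macdonald_weight (- s - p) 1 E (fst v) * macdonald_weight p 1 F (snd v))"
      by (simp add: boundary_weight_def norm_mult norm_macdonald_weight algebra_simps flip: exp_add)
  qed
qed

text \<open>
  In the coordinates \<open>t = u - z\<close> and \<open>r = ln (e\<^sup>z + e\<^sup>u) = z + ln (1 + e\<^sup>t)\<close>, whose Jacobian is \<open>1\<close>,
  one has \<open>E e\<^sup>-\<^sup>z + F e\<^sup>-\<^sup>u = e\<^sup>-\<^sup>r (1 + e\<^sup>t) (E + F e\<^sup>-\<^sup>t) = e\<^sup>-\<^sup>r (E + F + E e\<^sup>t + F e\<^sup>-\<^sup>t)\<close>, so that for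
  fixed \<open>r\<close> the integral over \<open>t\<close> is a Macdonald integral.
\<close>
lemma integral_boundary_weight:
  assumes s: "Re s > 0" and E: "E > 0" and F: "F > 0 \<or> F = 0 \<and> Re p > 0"
  shows "(\<integral>v. boundary_weight s p E F v \<partial>(lborel \<Otimes>\<^sub>M lborel))
    = (\<integral>z. macdonald_weight (- s) 1 (E + F) z
        * macdonald p (E * exp (- z)) (F * exp (- z)) \<partial>lborel)"
proof -
  let ?P = "lborel \<Otimes>\<^sub>M lborel :: (real \<times> real) measure"
  define f where "f = (\<lambda>z u. boundary_weight s p E F (z, u))"
  have f0: "integrable ?P (\<lambda>v. f (fst v) (snd v))"
    unfolding f_def using integrable_boundary_weight[OF assms] by simp
  \<comment> \<open>First \<open>u = t + z\<close> at fixed \<open>z\<close>, then \<open>z = r - ln (1 + e\<^sup>t)\<close> at fixed \<open>t\<close>; below, \<open>z\<close> stands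
      for \<open>r\<close>.\<close>
  define f1 where "f1 = (\<lambda>t z. f z (t + z))"
  have f1: "integrable ?P (\<lambda>v. f1 (fst v) (snd v))"
    "(\<integral>v. f1 (fst v) (snd v) \<partial>?P) = (\<integral>v. f (fst v) (snd v) \<partial>?P)"
    unfolding f1_def using integrable_shear[of "\<lambda>x. x", OF _ f0] integral_shear[of "\<lambda>x. x", OF _ f0]
        by auto
  define f2 where "f2 = (\<lambda>z t. f1 t (z + (- ln (1 + exp t))))"
  have h: "(\<lambda>x. - ln (1 + exp x) :: real) \<in> borel_measurable borel" by measurable
  have f2: "integrable ?P (\<lambda>v. f2 (fst v) (snd v))"
    "(\<integral>v. f2 (fst v) (snd v) \<partial>?P) = (\<integral>v. f1 (fst v) (snd v) \<partial>?P)"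
    unfolding f2_def using integrable_shear[OF h f1(1)] integral_shear[OF h f1(1)] by auto
  have eq: "f2 z t = macdonald_weight (- s) 1 (E + F) z
      * macdonald_weight p (E * exp (- z)) (F * exp (- z)) t" for z t
  proof -
    define r where "r = ln (1 + exp t)"
    have r: "exp r = 1 + exp t" unfolding r_def by (simp add: add_pos_pos)
    have "1 + exp t \<noteq> 0" using exp_gt_zero[of t] by linarith
    then have sum: "exp (z - r) + exp (t + (z - r)) = exp z"
      by (simp add: exp_diff exp_add r divide_simps) (simp add: algebra_simps)
    then have m: "log_sum_exp (z - r) (t + (z - r)) = z"
      by (simp add: log_sum_exp_def)
    have "exp (- (z - r)) = exp (- z) * (1 + exp t)"
      by (simp add: exp_diff exp_minus r field_simps)
    moreover have "exp (- (t + (z - r))) = exp (- z) * (exp (- t) + 1)"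
      using r by (simp add: exp_diff exp_minus exp_add field_simps)
    ultimately have e1: "exp (z - r) + E * exp (- (z - r))
        + (exp (t + (z - r)) + F * exp (- (t + (z - r))))
      = exp z + (E + F) * exp (- z) + (E * exp (- z) * exp t + F * exp (- z) * exp (- t))"
      using sum by (simp add: algebra_simps)
    have "f2 z t = exp (- s * complex_of_real (log_sum_exp (z - r) (t + (z - r))))
        * (macdonald_weight (- p) 1 E (z - r) * macdonald_weight p 1 F (t + (z - r)))"
      by (simp add: f2_def f1_def f_def boundary_weight_def r_def)
    also have "\<dots> = exp (- s * complex_of_real z + (p * complex_of_real t) - complex_of_real
      (exp (z - r) + E * exp (- (z - r)) + (exp (t + (z - r)) + F * exp (- (t + (z - r))))))"
      unfolding m by (simp add: macdonald_weight_def algebra_simps flip: exp_add)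
    finally show ?thesis unfolding e1 by (simp add: macdonald_weight_def algebra_simps flip:
        exp_add)
  qed
  have "(\<integral>v. boundary_weight s p E F v \<partial>?P) = (\<integral>v. f2 (fst v) (snd v) \<partial>?P)"
    using f1(2) f2(2) unfolding f_def by simp
  also have "\<dots> = (\<integral>z. (\<integral>t. f2 z t \<partial>lborel) \<partial>lborel)"
    using lborel_pair.integral_fst'[OF f2(1)] by simp
  finally show ?thesis unfolding eq by (simp add: macdonald_def)
qed

text \<open>
  The ratio of the coefficients \<open>E e\<^sup>-\<^sup>r\<close> and \<open>F e\<^sup>-\<^sup>r\<close> does not depend on \<open>r\<close>, so the reflection
  factor leaves the integral.
\<close>
lemma integral_boundary_weight_reflect:
  assumes "Re s > 0" "E > 0" "F > 0"
  shows "(\<integral>v. boundary_weight s p E F v \<partial>(lborel \<Otimes>\<^sub>M lborel))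
    = exp (p * complex_of_real (ln F - ln E))
        * (\<integral>v. boundary_weight s (- p) E F v \<partial>(lborel \<Otimes>\<^sub>M lborel))"
proof -
  have *: "macdonald p (E * exp (- z)) (F * exp (- z)) = exp (p * complex_of_real (ln F - ln E))
      * macdonald (- p) (E * exp (- z)) (F * exp (- z))" for z
    using macdonald_reflect[of "E * exp (- z)" "F * exp (- z)" p] assms by (simp add: ln_mult)
  show ?thesis
    using assms by (simp add: integral_boundary_weight * mult.left_commute[of _ "exp _"])
qed

text \<open>
  The case of rank one, in which the first site is also the last and \<open>u\<close> has no barrier at \<open>- \<infinity>\<close>.
\<close>
lemma integral_boundary_weight_zero:
  assumes "Re s > 0" "E > 0" "Re p > 0"
  shows "(\<integral>v. boundary_weight s p E 0 v \<partial>(lborel \<Otimes>\<^sub>M lborel))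
    = exp (- p * complex_of_real (ln E)) * (macdonald (p - s) 1 E * Gamma p)"
proof -
  have "macdonald_weight (- s) 1 E z * macdonald p (E * exp (- z)) 0
      = exp (- p * complex_of_real (ln E)) * (macdonald_weight (p - s) 1 E z * Gamma p)" for z
    using assms by (simp add: macdonald_zero ln_mult macdonald_weight_def exp_add[symmetric]
        algebra_simps)
  then show ?thesis
    using assms by (simp add: integral_boundary_weight macdonald_def)
qed

section \<open>Kernels as products of Macdonald integrals\<close>

lemma sum_shift1:
  "(\<Sum>i=1..Suc n. if i = 1 then a else f (i - 1)) = a + (\<Sum>i=1..n. f i)"
  for a :: "'a::comm_monoid_add"
  by (induction n) (auto simp: add.assoc)

text \<open>
  The coefficient of \<open>e\<^sup>z\<^sup>i\<close> in the potential of \<open>z\<^sub>i\<close>, which comes from the preceding outer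
  variables; the first site instead carries the boundary term \<open>e\<^sup>z\<close> with coefficient \<open>1\<close>.
\<close>
definition rise_coeff :: "(nat \<Rightarrow> real) \<Rightarrow> (nat \<Rightarrow> real) \<Rightarrow> nat \<Rightarrow> real" where
  "rise_coeff y x i = (if i = 1 then 1 else exp (- y (i - 1)) + exp (- x (i - 1)))"

text \<open>
  The coefficient of \<open>e\<^sup>-\<^sup>z\<^sup>i\<close> in the potential of \<open>z\<^sub>i\<close>. Only \<open>m\<close> of the variables \<open>x\<close> exist.
\<close>
definition fall_coeff :: "nat \<Rightarrow> (nat \<Rightarrow> real) \<Rightarrow> (nat \<Rightarrow> real) \<Rightarrow> nat \<Rightarrow> real" where
  "fall_coeff m y x i = exp (y i) + (if i \<le> m then exp (x i) else 0)"

text \<open>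
  For \<open>m = l - 1\<close> this is the recursive kernel at the spectral parameter \<open>s = \<i> \<mu>\<close>, and for \<open>m =
  l\<close> and \<open>s = \<i> \<gamma>\<close> the Baxter kernel at \<open>- \<gamma>\<close> without its Gamma factor.
\<close>
definition toda_kernel :: "nat \<Rightarrow> nat \<Rightarrow> (nat \<Rightarrow> real) \<Rightarrow> (nat \<Rightarrow> real) \<Rightarrow> complex \<Rightarrow> complex" where
  "toda_kernel l m y x s = exp (- s * complex_of_real ((\<Sum>i=1..l. y i) + (\<Sum>i=1..m. x i)))
     * (\<Prod>i=1..l. macdonald (2 * s) (rise_coeff y x i) (fall_coeff m y x i))"

lemma rise_coeff_pos: "rise_coeff y x i > 0" by (simp add: rise_coeff_def add_pos_pos)
lemma fall_coeff_pos: "fall_coeff m y x i > 0" by (simp add: fall_coeff_def add_pos_nonneg)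

text \<open>
  The relation between neighbouring coefficients that makes all products of reflection factors
  telescope.
\<close>
lemma ln_rise_coeff_Suc: "1 \<le> i \<Longrightarrow> i \<le> m \<Longrightarrow> ln (rise_coeff y x (Suc i)) = ln (fall_coeff m y x i)
    - y i - x i"
proof -
  assume i: "1 \<le> i" "i \<le> m"
  have "rise_coeff y x (Suc i) = fall_coeff m y x i * exp (- y i - x i)"
    using i by (simp add: rise_coeff_def fall_coeff_def exp_diff exp_minus field_simps)
  then show ?thesis using fall_coeff_pos[of m y x i] by (simp add: ln_mult)
qed

lemma sum_rise_coeff: "(\<Sum>i=1..Suc n. rise_coeff y x i * Z i) = Z 1
    + (\<Sum>i=1..n. (exp (- y i) + exp (- x i)) * Z (Suc i))"
  by (induction n) (simp_all add: rise_coeff_def)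

lemma sum_fall_coeff: "(\<Sum>i=1..n. fall_coeff n y x i * Z i)
    = (\<Sum>i=1..n. (exp (y i) + exp (x i)) * Z i)"
  by (intro sum.cong) (auto simp: fall_coeff_def)

lemma sum_fall_coeff_Suc: "(\<Sum>i=1..Suc n. fall_coeff n y x i * Z i)
    = (\<Sum>i=1..n. (exp (y i) + exp (x i)) * Z i) + exp (y (Suc n)) * Z (Suc n)"
  using sum_fall_coeff[of n y x Z] by (simp add: fall_coeff_def)

lemma prod_macdonald_weight: "(\<Prod>i\<in>I. macdonald_weight (s i) (A i) (B i) (t i))
    = exp ((\<Sum>i\<in>I. s i * complex_of_real (t i))
        - complex_of_real (\<Sum>i\<in>I. A i * exp (t i) + B i * exp (- t i)))"
  by (cases "finite I") (simp_all add: macdonald_weight_def exp_sum flip: sum_subtractf)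

lemma integral_sites:
  fixes f :: "nat \<Rightarrow> real \<Rightarrow> complex"
  assumes "\<And>i. i \<in> {1..n} \<Longrightarrow> integrable lborel (f i)"
  shows "(\<integral>z. c * (\<Prod>i=1..n. f i (z i)) \<partial>lebR n) = c * (\<Prod>i=1..n. integral\<^sup>L lborel (f i))"
  using lborel_sites.product_integral_prod[of "{1..n}" f] assms by simp

lemma recursive_kernel_eq_toda_kernel:
  "recursive_kernel (Suc n) x w \<mu> = toda_kernel (Suc n) n x w (\<i> * \<mu>)"
proof -
  let ?b = "\<i> * \<mu>"
  have "exp (- \<i> * \<mu> * complex_of_real
              ((\<Sum>i=1..Suc n. x i) - 2 * (\<Sum>i=1..Suc n. z i) + (\<Sum>i=1..Suc n-1. w i)))
        * complex_of_real (exp (- exp (z 1)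
            - (\<Sum>i=1..Suc n-1. exp (w i - z i) + exp (z (i+1) - w i)
                         + exp (x i - z i) + exp (z (i+1) - x i))
            - exp (x (Suc n) - z (Suc n))))
      = exp (- ?b * complex_of_real ((\<Sum>i=1..Suc n. x i) + (\<Sum>i=1..n. w i)))
        * (\<Prod>i=1..Suc n. macdonald_weight (2 * ?b) (rise_coeff x w i) (fall_coeff n x w i) (z i))"
            (is "?L = ?R") for z
  proof -
    have S: "exp (z 1) + (\<Sum>i=1..n. exp (w i - z i) + exp (z (Suc i) - w i) + exp (x i - z i)
        + exp (z (Suc i) - x i)) + exp (x (Suc n) - z (Suc n))
      = (\<Sum>i=1..Suc n. rise_coeff x w i * exp (z i) + fall_coeff n x w i * exp (- z i))"
      unfolding sum.distrib sum_rise_coeff sum_fall_coeff_Suc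
      by (simp add: sum.distrib distrib_left distrib_right exp_diff exp_minus divide_inverse
          mult.commute)
    have "?L = exp (- ?b * complex_of_real ((\<Sum>i=1..Suc n. x i) - 2 * (\<Sum>i=1..Suc n. z i)
        + (\<Sum>i=1..n. w i))
       - complex_of_real (exp (z 1) + (\<Sum>i=1..n. exp (w i - z i) + exp (z (Suc i) - w i)
           + exp (x i - z i) + exp (z (Suc i) - x i)) + exp (x (Suc n) - z (Suc n))))"
      unfolding exp_of_real[symmetric] exp_add[symmetric] by (simp add: algebra_simps)
    also have "\<dots> = ?R"
      unfolding S prod_macdonald_weight exp_add[symmetric]
      by (simp add: sum_distrib_left[symmetric] algebra_simps del: sum.cl_ivl_Suc)
    finally show ?thesis .
  qed
  then have "recursive_kernel (Suc n) x w \<mu> = (\<integral>z. exp (- ?b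
      * complex_of_real ((\<Sum>i=1..Suc n. x i) + (\<Sum>i=1..n. w i)))
        * (\<Prod>i=1..Suc n. macdonald_weight (2 * ?b) (rise_coeff x w i) (fall_coeff n x w i) (z i))
            \<partial>lebR (Suc n))"
    unfolding recursive_kernel_def by (simp del: sum.cl_ivl_Suc)
  also have "\<dots> = toda_kernel (Suc n) n x w ?b"
    unfolding toda_kernel_def macdonald_def
    by (rule integral_sites) (simp add: integrable_macdonald_weight rise_coeff_pos fall_coeff_pos)
  finally show ?thesis .
qed

lemma sum_ln_telescope:
  "(\<Sum>i=1..l. ln (fall_coeff l y x i) - ln (rise_coeff y x i)) - ln (rise_coeff y x (Suc l))
      = (\<Sum>i=1..l. y i + x i)"
proof -
  have "(\<Sum>i=1..l. ln (fall_coeff l y x i) - ln (rise_coeff y x i))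
    = (\<Sum>i=1..l. (ln (rise_coeff y x (Suc i)) - ln (rise_coeff y x i)) + (y i + x i))"
    by (intro sum.cong) (auto simp: ln_rise_coeff_Suc)
  also have "\<dots> = (ln (rise_coeff y x (Suc l)) - ln (rise_coeff y x 1)) + (\<Sum>i=1..l. y i + x i)"
    unfolding sum.distrib[of "\<lambda>i. ln (rise_coeff y x (Suc i)) - ln (rise_coeff y x i)"]
    by (subst sum_Suc_diff) simp_all
  finally show ?thesis by (simp add: rise_coeff_def)
qed

text \<open>
  Integrating out \<open>z\<^sub>l\<^sub>+\<^sub>1\<close>, which has no barrier at \<open>- \<infinity>\<close>, gives \<open>\<Gamma> (2 a)\<close>; reflecting the other
  \<open>z\<^sub>i\<close> changes \<open>2 a\<close> into \<open>- 2 a\<close>, and the factors telescope to \<open>exp (2 a \<Sum>(y\<^sub>i + x\<^sub>i))\<close>.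
\<close>
lemma baxter_kernel_eq_toda_kernel:
  assumes "Im \<gamma> > 0"
  shows "baxter_kernel l y x (- \<gamma>) = Gamma (- 2 * \<i> * \<gamma>) * toda_kernel l l y x (\<i> * \<gamma>)"
proof -
  define a where "a = - \<i> * \<gamma>"
  have a: "Re a > 0" using assms by (simp add: a_def)
  have ia: "\<i> * \<gamma> = - a" "- \<i> * (- \<gamma>) = - a" "- 2 * \<i> * \<gamma> = 2 * a" by (simp_all add: a_def)
  let ?B = "\<lambda>i. if i \<le> l then fall_coeff l y x i else 0"
  let ?c = "exp (- a * complex_of_real ((\<Sum>i=1..l. y i) + (\<Sum>i=1..l. x i)))"
  have "exp (- a * complex_of_real
              ((\<Sum>i=1..l. y i) - 2 * (\<Sum>i=1..l+1. z i) + (\<Sum>i=1..l. x i)))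
        * complex_of_real (exp (- exp (z 1)
            - (\<Sum>i=1..l. exp (y i - z i) + exp (z (i+1) - y i)
                       + exp (x i - z i) + exp (z (i+1) - x i))))
      = ?c * (\<Prod>i=1..Suc l. macdonald_weight (2 * a) (rise_coeff y x i) (?B i) (z i))" (is "?L = ?R")
          for z
  proof -
    have B: "(\<Sum>i=1..Suc l. ?B i * exp (- z i)) = (\<Sum>i=1..l. fall_coeff l y x i * exp (- z i))"
      by simp
    have S: "exp (z 1) + (\<Sum>i=1..l. exp (y i - z i) + exp (z (Suc i) - y i) + exp (x i - z i)
        + exp (z (Suc i) - x i))
      = (\<Sum>i=1..Suc l. rise_coeff y x i * exp (z i) + ?B i * exp (- z i))"
      unfolding sum.distrib[of "\<lambda>i. rise_coeff y x i * exp (z i)"] B sum_rise_coeff sum_fall_coeff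
      by (simp add: sum.distrib distrib_left distrib_right exp_diff exp_minus divide_inverse
          mult.commute)
    have "?L = exp (- a * complex_of_real ((\<Sum>i=1..l. y i) - 2 * (\<Sum>i=1..Suc l. z i) + (\<Sum>i=1..l. x i))
       - complex_of_real (exp (z 1) + (\<Sum>i=1..l. exp (y i - z i) + exp (z (Suc i) - y i)
           + exp (x i - z i) + exp (z (Suc i) - x i))))"
      unfolding exp_of_real[symmetric] exp_add[symmetric] by (simp add: algebra_simps)
    also have "\<dots> = ?R"
      unfolding S prod_macdonald_weight exp_add[symmetric]
      by (simp add: sum_distrib_left[symmetric] algebra_simps del: sum.cl_ivl_Suc)
    finally show ?thesis .
  qed
  then have "baxter_kernel l y x (- \<gamma>) = (\<integral>z. ?c
      * (\<Prod>i=1..Suc l. macdonald_weight (2 * a) (rise_coeff y x i) (?B i) (z i)) \<partial>lebR (Suc l))"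
    unfolding baxter_kernel_def ia by (simp del: sum.cl_ivl_Suc)
  also have "\<dots> = ?c * (\<Prod>i=1..Suc l. macdonald (2 * a) (rise_coeff y x i) (?B i))"
    unfolding macdonald_def using a by (intro integral_sites)
        (auto intro!: integrable_macdonald_weight simp: rise_coeff_pos fall_coeff_pos)
  also have "(\<Prod>i=1..Suc l. macdonald (2 * a) (rise_coeff y x i) (?B i))
      = (\<Prod>i=1..l. macdonald (2 * a) (rise_coeff y x i) (fall_coeff l y x i))
          * macdonald (2 * a) (rise_coeff y x (Suc l)) 0"
    by simp
  also have "(\<Prod>i=1..l. macdonald (2 * a) (rise_coeff y x i) (fall_coeff l y x i))
     = (\<Prod>i=1..l. exp (2 * a * complex_of_real (ln (fall_coeff l y x i) - ln (rise_coeff y x i)))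
         * macdonald (2 * (- a)) (rise_coeff y x i) (fall_coeff l y x i))"
    using macdonald_reflect[of "rise_coeff y x _" "fall_coeff l y x _" "2 * a"]
        by (intro prod.cong) (auto simp: rise_coeff_pos fall_coeff_pos)
  also have "\<dots> = exp (2 * a * complex_of_real (\<Sum>i=1..l. ln (fall_coeff l y x i)
      - ln (rise_coeff y x i))) *
      (\<Prod>i=1..l. macdonald (2 * (- a)) (rise_coeff y x i) (fall_coeff l y x i))"
    by (simp add: prod.distrib sum_distrib_left exp_sum)
  also have "macdonald (2 * a) (rise_coeff y x (Suc l)) 0
      = exp (- (2 * a) * complex_of_real (ln (rise_coeff y x (Suc l)))) * Gamma (2 * a)"
    using a by (intro macdonald_zero) (auto simp: rise_coeff_pos)
  finally have "baxter_kernel l y x (- \<gamma>) = exp (- a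
      * complex_of_real ((\<Sum>i=1..l. y i) + (\<Sum>i=1..l. x i)) +
      2 * a * complex_of_real ((\<Sum>i=1..l. ln (fall_coeff l y x i) - ln (rise_coeff y x i))
          - ln (rise_coeff y x (Suc l)))) *
     (\<Prod>i=1..l. macdonald (2 * (- a)) (rise_coeff y x i) (fall_coeff l y x i)) * Gamma (2 * a)"
    by (simp add: exp_add exp_diff exp_minus algebra_simps divide_inverse)
  then show ?thesis
    unfolding sum_ln_telescope ia toda_kernel_def by (simp add: sum.distrib algebra_simps)
qed

text \<open>
  A large \<open>x\<^sub>i\<close> makes the fall coefficient of site \<open>i\<close> large, a very negative one the rise
  coefficient of site \<open>i + 1\<close>. Either is worth a factor \<open>exp (- k \<bar>x\<^sub>i\<bar>)\<close>; the price is an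
  exponential of \<open>y\<close>, because \<open>y\<close> bounds both coefficients from below.
\<close>
lemma site_bound:
  assumes k: "k \<ge> 0"
  shows "\<exists>C\<ge>0. \<exists>N\<ge>0. \<forall>m y x i. i > 0 \<longrightarrow> norm (macdonald s (rise_coeff y x i) (fall_coeff m y x i))
      \<le> C *
    exp (N * ((if i = 1 then 0 else \<bar>y (i - 1)\<bar>) + \<bar>y i\<bar>) + k
        * ((if i = 1 then 0 else min (x (i - 1)) 0) - (if i \<le> m then max (x i) 0 else 0)))"
proof -
  define j where "j = \<bar>Re s\<bar> + 1"
  have j: "j \<ge> 0" by (simp add: j_def)
  obtain C where C: "C \<ge> 0" and le: "\<And>A B. A > 0 \<Longrightarrow> B > 0 \<Longrightarrow> norm (macdonald s A B)
     \<le> C * (exp (- (k + j) * ln A - k * ln B) + exp (- k * ln A - (k + j) * ln B))"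
    using norm_macdonald_bound[of k s j] k by (auto simp: j_def)
  have "norm (macdonald s (rise_coeff y x i) (fall_coeff m y x i)) \<le> 2 * C *
    exp ((k + j) * ((if i = 1 then 0 else \<bar>y (i - 1)\<bar>) + \<bar>y i\<bar>) + k
        * ((if i = 1 then 0 else min (x (i - 1)) 0) - (if i \<le> m then max (x i) 0 else 0)))" (is "_
        \<le> _ * exp ?e")
    if "i > 0" for m y x i
  proof -
    let ?al = "if i = 1 then 0 else \<bar>y (i - 1)\<bar>" and ?al' = "if i = 1 then 0 else min (x (i - 1)) 0"
    let ?be = "\<bar>y i\<bar>" and ?be' = "- (if i \<le> m then max (x i) 0 else 0)"
    have A: "- ln (rise_coeff y x i) \<le> ?al + ?al'"
    proof (cases "i = 1")
      case False
      have "- y (i - 1) \<le> ln (rise_coeff y x i)"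
        using False by (subst ln_ge_iff) (simp_all add: rise_coeff_pos, simp add: rise_coeff_def)
      moreover have "- x (i - 1) \<le> ln (rise_coeff y x i)"
        using False by (subst ln_ge_iff) (simp_all add: rise_coeff_pos, simp add: rise_coeff_def)
      ultimately show ?thesis using False by auto
    qed (simp add: rise_coeff_def)
    have B: "- ln (fall_coeff m y x i) \<le> ?be + ?be'"
    proof -
      have "y i \<le> ln (fall_coeff m y x i)"
        by (subst ln_ge_iff) (simp_all add: fall_coeff_pos, simp add: fall_coeff_def)
      moreover have "x i \<le> ln (fall_coeff m y x i)" if "i \<le> m"
        using that by (subst ln_ge_iff) (simp_all add: fall_coeff_pos, simp add: fall_coeff_def)
      ultimately show ?thesis by auto
    qed
    have A': "- ln (rise_coeff y x i) \<le> ?al" using A by (auto split: if_splits)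
    have B': "- ln (fall_coeff m y x i) \<le> ?be" using B by (auto split: if_splits)
    have "- (k + j) * ln (rise_coeff y x i) - k * ln (fall_coeff m y x i) = k
        * (- ln (rise_coeff y x i)) + j * (- ln (rise_coeff y x i)) + k
        * (- ln (fall_coeff m y x i))"
      by (simp add: algebra_simps)
    also have "\<dots> \<le> k * (?al + ?al') + j * ?al + k * (?be + ?be')"
      by (intro add_mono mult_left_mono A B A' k j)
    also have "\<dots> \<le> ?e" using j by (simp add: algebra_simps)
    finally have 1: "- (k + j) * ln (rise_coeff y x i) - k * ln (fall_coeff m y x i) \<le> ?e" .
    have "- k * ln (rise_coeff y x i) - (k + j) * ln (fall_coeff m y x i) = k
        * (- ln (rise_coeff y x i)) + j * (- ln (fall_coeff m y x i)) + k
        * (- ln (fall_coeff m y x i))"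
      by (simp add: algebra_simps)
    also have "\<dots> \<le> k * (?al + ?al') + j * ?be + k * (?be + ?be')"
      by (intro add_mono mult_left_mono A B B' k j)
    also have "\<dots> \<le> ?e" using j by (simp add: algebra_simps)
    finally have 2: "- k * ln (rise_coeff y x i) - (k + j) * ln (fall_coeff m y x i) \<le> ?e" .
    have "norm (macdonald s (rise_coeff y x i) (fall_coeff m y x i)) \<le> C * (exp ?e + exp ?e)"
      using le[OF rise_coeff_pos fall_coeff_pos, of y x i m y x i] 1 2 C
      by (elim order_trans) (intro mult_left_mono add_mono; simp)
    then show ?thesis by simp
  qed
  then show ?thesis using C j k by (intro exI[of _ "2 * C"] exI[of _ "k + j"] conjI) auto
qed

lemma norm_exp_sum_le:
  fixes s :: complex
  shows "norm (exp (- s * complex_of_real ((\<Sum>i=1..l. y i) + (\<Sum>i=1..m. x i))))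
    \<le> exp (\<bar>Re s\<bar> * ((\<Sum>i=1..l. \<bar>y i\<bar>) + (\<Sum>i=1..m. \<bar>x i\<bar>)))"
proof -
  have "- Re s * ((\<Sum>i=1..l. y i) + (\<Sum>i=1..m. x i)) \<le> \<bar>Re s\<bar> * \<bar>(\<Sum>i=1..l. y i) + (\<Sum>i=1..m. x i)\<bar>"
    using abs_ge_self[of "- Re s * ((\<Sum>i=1..l. y i) + (\<Sum>i=1..m. x i))"] by (simp add: abs_mult)
  also have "\<dots> \<le> \<bar>Re s\<bar> * ((\<Sum>i=1..l. \<bar>y i\<bar>) + (\<Sum>i=1..m. \<bar>x i\<bar>))"
    using sum_abs[of y "{1..l}"] sum_abs[of x "{1..m}"] by (intro mult_left_mono) linarith+
  finally show ?thesis by (simp add: norm_exp_eq_Re)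
qed

text \<open>
  The exponent \<open>k\<close> is at our disposal: in those \<open>x\<^sub>i\<close> with \<open>i < l\<close> the kernel decays faster than
  any exponential.
\<close>
lemma toda_kernel_bound:
  assumes k: "k \<ge> 0" and m: "m = l \<or> Suc m = l"
  shows "\<exists>C\<ge>0. \<exists>N\<ge>0. \<forall>y x. norm (toda_kernel l m y x s) \<le> C * exp (N * (\<Sum>i=1..l. \<bar>y i\<bar>)
     + \<bar>Re s\<bar> * (\<Sum>i=1..m. \<bar>x i\<bar>) - k * (\<Sum>i=1..l-1. \<bar>x i\<bar>))"
proof -
  obtain C N where C: "C \<ge> 0" and N: "N \<ge> 0" and le:
      "\<And>m y x i. i > 0 \<Longrightarrow> norm (macdonald (2 * s) (rise_coeff y x i) (fall_coeff m y x i)) \<le> C *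
    exp (N * ((if i = 1 then 0 else \<bar>y (i - 1)\<bar>) + \<bar>y i\<bar>) + k
        * ((if i = 1 then 0 else min (x (i - 1)) 0) - (if i \<le> m then max (x i) 0 else 0)))"
    using site_bound[OF k, of "2 * s"] by metis
  have "norm (toda_kernel l m y x s) \<le> C ^ l * exp ((2 * N + \<bar>Re s\<bar>) * (\<Sum>i=1..l. \<bar>y i\<bar>)
     + \<bar>Re s\<bar> * (\<Sum>i=1..m. \<bar>x i\<bar>) - k * (\<Sum>i=1..l-1. \<bar>x i\<bar>))" for y x
  proof -
    let ?e = "\<lambda>i. N * ((if i = 1 then 0 else \<bar>y (i - 1)\<bar>) + \<bar>y i\<bar>) + k
        * ((if i = 1 then 0 else min (x (i - 1)) 0) - (if i \<le> m then max (x i) 0 else 0))"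
    have "norm (\<Prod>i=1..l. macdonald (2 * s) (rise_coeff y x i) (fall_coeff m y x i))
        \<le> (\<Prod>i=1..l. C * exp (?e i))"
      unfolding prod_norm[symmetric]
      by (intro prod_mono conjI norm_ge_zero le) auto
    also have "\<dots> = C ^ l * exp (\<Sum>i=1..l. ?e i)"
      by (simp add: prod.distrib exp_sum)
    also have "(\<Sum>i=1..l. ?e i) \<le> 2 * N * (\<Sum>i=1..l. \<bar>y i\<bar>) - k * (\<Sum>i=1..l-1. \<bar>x i\<bar>)"
    proof (cases l)
      case (Suc n)
      have "(\<Sum>i=1..Suc n. ?e i) = N * ((\<Sum>i=1..n. \<bar>y i\<bar>) + (\<Sum>i=1..Suc n. \<bar>y i\<bar>))
         + k * ((\<Sum>i=1..n. min (x i) 0) - (\<Sum>i=1..Suc n. if i \<le> m then max (x i) 0 else 0))"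
        unfolding sum.distrib sum_distrib_left[symmetric] sum_subtractf
          sum_shift1[of _ "\<lambda>i. \<bar>y i\<bar>"] sum_shift1[of _ "\<lambda>i. min (x i) 0"]
              by (simp del: sum.cl_ivl_Suc)
      \<comment> \<open>For \<open>i \<le> n\<close> the contributions of sites \<open>i\<close> and \<open>i + 1\<close> combine to \<open>min x 0 - max x 0
          = - \<bar>x\<bar>\<close>; the rest is discarded.\<close>
      also have "\<dots> \<le> N * ((\<Sum>i=1..Suc n. \<bar>y i\<bar>) + (\<Sum>i=1..Suc n. \<bar>y i\<bar>))
         + k * (- (\<Sum>i=1..n. \<bar>x i\<bar>))"
      proof (intro add_mono mult_left_mono N k)
        have "(\<Sum>i=1..n. max (x i) 0) = (\<Sum>i=1..n. if i \<le> m then max (x i) 0 else 0)"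
          using m Suc by (intro sum.cong) auto
        also have "\<dots> \<le> (\<Sum>i=1..Suc n. if i \<le> m then max (x i) 0 else 0)" by simp
        finally have "(\<Sum>i=1..n. min (x i) 0) - (\<Sum>i=1..Suc n. if i \<le> m then max (x i) 0 else 0)
           \<le> (\<Sum>i=1..n. min (x i) 0 - max (x i) 0)" by (simp add: sum_subtractf)
        also have "\<dots> = - (\<Sum>i=1..n. \<bar>x i\<bar>)"
          unfolding sum_negf[symmetric] by (intro sum.cong) auto
        finally show "(\<Sum>i=1..n. min (x i) 0) - (\<Sum>i=1..Suc n. if i \<le> m then max (x i) 0 else 0) \<le>
            - (\<Sum>i=1..n. \<bar>x i\<bar>)" .
      qed auto
      finally show ?thesis using Suc by (simp add: algebra_simps)
    qed simp
    finally have P: "norm (\<Prod>i=1..l. macdonald (2 * s) (rise_coeff y x i) (fall_coeff m y x i))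
        \<le> C ^ l * exp (2 * N * (\<Sum>i=1..l. \<bar>y i\<bar>) - k * (\<Sum>i=1..l-1. \<bar>x i\<bar>))"
      using C by (simp add: mult_left_mono)
    have "norm (toda_kernel l m y x s) \<le> exp (\<bar>Re s\<bar> * ((\<Sum>i=1..l. \<bar>y i\<bar>) + (\<Sum>i=1..m. \<bar>x i\<bar>))) *
       (C ^ l * exp (2 * N * (\<Sum>i=1..l. \<bar>y i\<bar>) - k * (\<Sum>i=1..l-1. \<bar>x i\<bar>)))"
      unfolding toda_kernel_def norm_mult by (intro mult_mono P norm_exp_sum_le) auto
    also have "\<dots> = C ^ l * exp ((2 * N + \<bar>Re s\<bar>) * (\<Sum>i=1..l. \<bar>y i\<bar>)
     + \<bar>Re s\<bar> * (\<Sum>i=1..m. \<bar>x i\<bar>) - k * (\<Sum>i=1..l-1. \<bar>x i\<bar>))"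
      by (simp add: algebra_simps flip: exp_add)
    finally show ?thesis .
  qed
  then show ?thesis using C N by (intro exI[of _ "C ^ l"] exI[of _ "2 * N + \<bar>Re s\<bar>"] conjI) auto
qed

section \<open>Four integrands for the exchange of two kernels\<close>

lemma prod_first: "(\<Prod>i=1..Suc n. (if i = 1 then c else 1) * f i) = c * (\<Prod>i=1..Suc n. f i)"
  for c :: "'a::comm_monoid_mult"
  unfolding prod.distrib by (simp add: prod.delta del: prod.cl_ivl_Suc)

lemma integrable_sites2:
  fixes f :: "nat \<Rightarrow> real \<times> real \<Rightarrow> complex"
  assumes "\<And>i. i \<in> {1..n} \<Longrightarrow> integrable (lborel \<Otimes>\<^sub>M lborel) (f i)"
  shows "integrable (lebR2 n) (\<lambda>v. c * (\<Prod>i=1..n. f i (v i)))"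
  using lborel2_sites.product_integrable_prod[of "{1..n}" f] assms by simp

lemma integral_sites2:
  fixes f :: "nat \<Rightarrow> real \<times> real \<Rightarrow> complex"
  assumes "\<And>i. i \<in> {1..n} \<Longrightarrow> integrable (lborel \<Otimes>\<^sub>M lborel) (f i)"
  shows "(\<integral>v. c * (\<Prod>i=1..n. f i (v i)) \<partial>lebR2 n) = c
      * (\<Prod>i=1..n. integral\<^sup>L (lborel \<Otimes>\<^sub>M lborel) (f i))"
  using lborel2_sites.product_integral_prod[of "{1..n}" f] assms by simp

lemma integrable_sites:
  fixes f :: "nat \<Rightarrow> real \<Rightarrow> complex"
  assumes "\<And>i. i \<in> {1..n} \<Longrightarrow> integrable lborel (f i)"
  shows "integrable (lebR n) (\<lambda>z. c * (\<Prod>i=1..n. f i (z i)))"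
  using lborel_sites.product_integrable_prod[of "{1..n}" f] assms by simp

text \<open>
  The last site has no \<open>u\<close>-barrier at \<open>- \<infinity>\<close> once the last variable \<open>x\<close> has been integrated out.
\<close>
definition cut_fall_coeff :: "nat \<Rightarrow> (nat \<Rightarrow> real) \<Rightarrow> (nat \<Rightarrow> real) \<Rightarrow> nat \<Rightarrow> real" where
  "cut_fall_coeff n x w i = (if i \<le> n then exp (x i) + exp (w i) else 0)"

text \<open>
  On the right-hand side \<open>u\<^sub>n\<^sub>+\<^sub>1\<close> is decoupled from everything. It is kept, with the Gamma integrand
  \<open>exp (p u - e\<^sup>u)\<close>, so that both sides live on the same space.
\<close>
definition cut_rise_coeff :: "nat \<Rightarrow> (nat \<Rightarrow> real) \<Rightarrow> (nat \<Rightarrow> real) \<Rightarrow> nat \<Rightarrow> real" where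
  "cut_rise_coeff n x w i = (if i \<le> n then rise_coeff x w i else 1)"

text \<open>
  For \<open>n = 0\<close> the variable \<open>u\<^sub>1\<close> is the decoupled one and drops out of the coupling.
\<close>
definition first_log :: "nat \<Rightarrow> real \<times> real \<Rightarrow> real" where
  "first_log n v = (if n = 0 then fst v else log_sum_exp (fst v) (snd v))"

text \<open>
  The spectral parameters enter through \<open>s = a - b\<close> and \<open>p = a + b\<close>, that is \<open>2 a = p + s\<close> and \<open>2
  b = p - s\<close>. In this form the reflection of \<open>x\<close> flips the sign of \<open>s\<close> and that of \<open>(z, u)\<close> the
  sign of \<open>p\<close>. The four integrands below are, in this order: the left-hand side; the same after
  reflecting \<open>x\<close>; the right-hand side after reflecting \<open>x\<close>; the right-hand side.
\<close>
definition left_site where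
  "left_site n s p y w x i v = macdonald_weight (- (p + s)) (rise_coeff y x i)
      (fall_coeff (Suc n) y x i) (fst v) * macdonald_weight (p
      - s) (rise_coeff x w i) (fall_coeff n x w i) (snd v)"

definition left_reflected_site where
  "left_reflected_site n s p y w x i v = (if i
      = (1::nat) then exp (- s * complex_of_real (log_sum_exp (fst v) (snd v))) else 1)
    * (macdonald_weight (- p) (rise_coeff y x i) (fall_coeff n y x i) (fst v)
        * macdonald_weight p (rise_coeff x w i) (cut_fall_coeff n x w i) (snd v))"

definition right_reflected_site where
  "right_reflected_site n s p y w x i v = (if i
      = (1::nat) then exp (- s * complex_of_real (first_log n v)) else 1)
    * (macdonald_weight p (rise_coeff y x i) (fall_coeff n y x i) (fst v)
        * macdonald_weight (if i \<le> n then - p else p) (cut_rise_coeff n x w i)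
        (cut_fall_coeff n x w i) (snd v))"

definition right_site where
  "right_site n s p y w x i v = macdonald_weight (p - s) (rise_coeff y x i) (fall_coeff n y x i)
      (fst v)
    * macdonald_weight (if i \<le> n then - (p + s) else p) (cut_rise_coeff n x w i)
        (cut_fall_coeff n x w i) (snd v)"

definition left_integrand :: "nat \<Rightarrow> complex \<Rightarrow> complex \<Rightarrow> (nat \<Rightarrow> real) \<Rightarrow> (nat \<Rightarrow> real) \<Rightarrow> (nat \<Rightarrow> real) \<Rightarrow>
    (nat \<Rightarrow> real \<times> real) \<Rightarrow> complex" where
  "left_integrand n s p y w x v = exp ((p + s) / 2 * complex_of_real (\<Sum>i=1..Suc n. y i)
      - (p - s) / 2 * complex_of_real (\<Sum>i=1..n. w i) + s * complex_of_real (\<Sum>i=1..Suc n. x i))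
     * (\<Prod>i=1..Suc n. left_site n s p y w x i (v i))"

definition left_reflected :: "nat \<Rightarrow> complex \<Rightarrow> complex \<Rightarrow> (nat \<Rightarrow> real) \<Rightarrow> (nat \<Rightarrow> real) \<Rightarrow> (nat \<Rightarrow> real) \<Rightarrow>
    (nat \<Rightarrow> real \<times> real) \<Rightarrow> complex" where
  "left_reflected n s p y w x v = exp ((p + s) / 2 * complex_of_real (\<Sum>i=1..Suc n. y i)
      - (p - s) / 2 * complex_of_real (\<Sum>i=1..n. w i) - s * complex_of_real (\<Sum>i=1..n. x i))
     * (\<Prod>i=1..Suc n. left_reflected_site n s p y w x i (v i))"

definition right_reflected :: "nat \<Rightarrow> complex \<Rightarrow> complex \<Rightarrow> (nat \<Rightarrow> real) \<Rightarrow> (nat \<Rightarrow> real) \<Rightarrow> (nat \<Rightarrow> real)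
    \<Rightarrow> (nat \<Rightarrow> real \<times> real) \<Rightarrow> complex" where
  "right_reflected n s p y w x v = exp (- (p - s) / 2 * complex_of_real (\<Sum>i=1..Suc n. y i)
      + (p + s) / 2 * complex_of_real (\<Sum>i=1..n. w i) - s * complex_of_real (\<Sum>i=1..n. x i))
     * (\<Prod>i=1..Suc n. right_reflected_site n s p y w x i (v i))"

definition right_integrand :: "nat \<Rightarrow> complex \<Rightarrow> complex \<Rightarrow> (nat \<Rightarrow> real) \<Rightarrow> (nat \<Rightarrow> real) \<Rightarrow> (nat \<Rightarrow> real)
    \<Rightarrow> (nat \<Rightarrow> real \<times> real) \<Rightarrow> complex" where
  "right_integrand n s p y w x v = exp (- (p - s) / 2 * complex_of_real (\<Sum>i=1..Suc n. y i)
      + (p + s) / 2 * complex_of_real (\<Sum>i=1..n. w i) + s * complex_of_real (\<Sum>i=1..n. x i))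
     * (\<Prod>i=1..Suc n. right_site n s p y w x i (v i))"

lemma of_real_norm_exp: "complex_of_real (norm (exp c)) = exp (complex_of_real (Re c))"
  by (simp add: norm_exp_eq_Re exp_of_real)

text \<open>
  Passing to the real parts of the parameters turns each integrand into its absolute value.
\<close>
lemma of_real_norm_left_site: "complex_of_real (norm (left_site n s p y w x i v))
    = left_site n (Re s) (Re p) y w x i v"
  by (simp add: left_site_def norm_mult of_real_norm_macdonald_weight)
lemma of_real_norm_left_reflected_site: "complex_of_real
    (norm (left_reflected_site n s p y w x i v)) = left_reflected_site n (Re s) (Re p) y w x i v"
  by (simp add: left_reflected_site_def norm_mult norm_exp_eq_Re of_real_norm_macdonald_weight flip:
      exp_of_real)
lemma of_real_norm_right_reflected_site: "complex_of_real
    (norm (right_reflected_site n s p y w x i v)) = right_reflected_site n (Re s) (Re p) y w x i v"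
  by (simp add: right_reflected_site_def norm_mult norm_exp_eq_Re of_real_norm_macdonald_weight
      flip: exp_of_real)
lemma of_real_norm_right_site: "complex_of_real (norm (right_site n s p y w x i v))
    = right_site n (Re s) (Re p) y w x i v"
  by (simp add: right_site_def norm_mult norm_exp_eq_Re of_real_norm_macdonald_weight flip:
      exp_of_real)

lemma of_real_norm_left_integrand: "complex_of_real (norm (left_integrand n s p y w x v))
    = left_integrand n (Re s) (Re p) y w x v"
  unfolding left_integrand_def norm_mult of_real_mult of_real_norm_exp prod_norm[symmetric]
      of_real_prod of_real_norm_left_site by simp
lemma of_real_norm_left_reflected: "complex_of_real (norm (left_reflected n s p y w x v))
    = left_reflected n (Re s) (Re p) y w x v"
  unfolding left_reflected_def norm_mult of_real_mult of_real_norm_exp prod_norm[symmetric]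
      of_real_prod of_real_norm_left_reflected_site by simp
lemma of_real_norm_right_reflected: "complex_of_real (norm (right_reflected n s p y w x v))
    = right_reflected n (Re s) (Re p) y w x v"
  unfolding right_reflected_def norm_mult of_real_mult of_real_norm_exp prod_norm[symmetric]
      of_real_prod of_real_norm_right_reflected_site by simp
lemma of_real_norm_right_integrand: "complex_of_real (norm (right_integrand n s p y w x v))
    = right_integrand n (Re s) (Re p) y w x v"
  unfolding right_integrand_def norm_mult of_real_mult of_real_norm_exp prod_norm[symmetric]
      of_real_prod of_real_norm_right_site by simp

lemma le_of_complex_eq:
  assumes "complex_of_real A = c * complex_of_real B" "B \<ge> 0"
  shows "A \<le> norm c * B"
proof -
  have "\<bar>A\<bar> = norm c * \<bar>B\<bar>"
    using arg_cong[OF assms(1), of norm] by (simp add: norm_mult)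
  then show ?thesis using assms(2) by simp
qed

text \<open>
  An identity valid for all parameters also holds for their real parts, where it compares
  integrals of absolute values.
\<close>
lemma norm_transfer:
  fixes f :: "complex \<Rightarrow> complex \<Rightarrow> 'a \<Rightarrow> complex" and g :: "complex \<Rightarrow> complex \<Rightarrow> 'b \<Rightarrow> complex"
  assumes eq: "\<And>s p. Re s > 0 \<Longrightarrow> Re p > 0 \<Longrightarrow> (\<integral>v. f s p v \<partial>M) = c s p * (\<integral>v. g s p v \<partial>N)"
    and f: "\<And>s p v. complex_of_real (norm (f s p v)) = f (Re s) (Re p) v"
    and g: "\<And>s p v. complex_of_real (norm (g s p v)) = g (Re s) (Re p) v"
    and pos: "Re s > 0" "Re p > 0"
  shows "(\<integral>v. norm (f s p v) \<partial>M) \<le> norm (c (Re s) (Re p)) * (\<integral>v. norm (g s p v) \<partial>N)"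
proof -
  have F: "complex_of_real (\<integral>v. norm (f s p v) \<partial>M) = (\<integral>v. f (Re s) (Re p) v \<partial>M)"
    unfolding f[symmetric] by simp
  have G: "complex_of_real (\<integral>v. norm (g s p v) \<partial>N) = (\<integral>v. g (Re s) (Re p) v \<partial>N)"
    unfolding g[symmetric] by simp
  show ?thesis
    by (rule le_of_complex_eq) (use F G eq[of "Re s" "Re p"] pos in simp_all)
qed

lemma measurable_exp_complex:
  fixes f :: "'a \<Rightarrow> complex"
  assumes "f \<in> borel_measurable M"
  shows "(\<lambda>q. exp (f q)) \<in> borel_measurable M"
  using assms by measurable

lemma measurable_complex_of_real:
  assumes "f \<in> borel_measurable M"
  shows "(\<lambda>q. complex_of_real (f q)) \<in> borel_measurable M"
  using assms by measurable

lemma measurable_rise_coeff: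
  assumes "i \<ge> 1" "\<And>j. 1 \<le> j \<Longrightarrow> j < i \<Longrightarrow> (\<lambda>q. f q j) \<in> borel_measurable M"
     "\<And>j. 1 \<le> j \<Longrightarrow> j < i \<Longrightarrow> (\<lambda>q. g q j) \<in> borel_measurable M"
  shows "(\<lambda>q. rise_coeff (f q) (g q) i) \<in> borel_measurable M"
proof (cases "i = 1")
  case False
  then have [measurable]: "(\<lambda>q. f q (i - 1)) \<in> borel_measurable M"
      "(\<lambda>q. g q (i - 1)) \<in> borel_measurable M"
    using assms by auto
  have "(\<lambda>q. rise_coeff (f q) (g q) i) = (\<lambda>q. exp (- f q (i - 1)) + exp (- g q (i - 1)))"
    using False by (simp add: rise_coeff_def)
  moreover have "\<dots> \<in> borel_measurable M" by measurable
  ultimately show ?thesis by simp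
qed (simp add: rise_coeff_def)

lemma measurable_fall_coeff:
  assumes [measurable]: "(\<lambda>q. f q i) \<in> borel_measurable M" and
      "i \<le> m \<Longrightarrow> (\<lambda>q. g q i) \<in> borel_measurable M"
  shows "(\<lambda>q. fall_coeff m (f q) (g q) i) \<in> borel_measurable M"
  using assms(2) by (cases "i \<le> m") (auto simp: fall_coeff_def)

lemma measurable_cut_fall_coeff:
  assumes "i \<le> m \<Longrightarrow> (\<lambda>q. f q i) \<in> borel_measurable M" and "i \<le> m \<Longrightarrow> (\<lambda>q. g q i) \<in> borel_measurable M"
  shows "(\<lambda>q. cut_fall_coeff m (f q) (g q) i) \<in> borel_measurable M"
  using assms by (cases "i \<le> m") (auto simp: cut_fall_coeff_def)

lemma measurable_cut_rise_coeff:
  assumes "i \<ge> 1" "\<And>j. 1 \<le> j \<Longrightarrow> j < i \<Longrightarrow> (\<lambda>q. f q j) \<in> borel_measurable M"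
     "\<And>j. 1 \<le> j \<Longrightarrow> j < i \<Longrightarrow> (\<lambda>q. g q j) \<in> borel_measurable M"
  shows "(\<lambda>q. cut_rise_coeff n (f q) (g q) i) \<in> borel_measurable M"
  using measurable_rise_coeff[OF assms] by (cases "i \<le> n") (auto simp: cut_rise_coeff_def)

lemma measurable_toda_kernel:
  assumes "l \<le> Suc m" "\<And>i. i \<in> {1..l} \<Longrightarrow> (\<lambda>q. f q i) \<in> borel_measurable M"
    and "\<And>i. i \<in> {1..m} \<Longrightarrow> (\<lambda>q. g q i) \<in> borel_measurable M"
  shows "(\<lambda>q. toda_kernel l m (f q) (g q) s) \<in> borel_measurable M"
  unfolding toda_kernel_def using assms
  by (intro borel_measurable_times borel_measurable_prod measurable_exp_complex
      measurable_complex_of_real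
      borel_measurable_add borel_measurable_sum borel_measurable_const measurable_macdonald
          measurable_rise_coeff measurable_fall_coeff) auto

context
  fixes X :: "'q \<Rightarrow> nat \<Rightarrow> real" and V :: "'q \<Rightarrow> nat \<Rightarrow> real \<times> real" and M and n :: nat
  assumes X: "\<And>i. i \<in> {1..n} \<Longrightarrow> (\<lambda>q. X q i) \<in> borel_measurable M"
    and V1: "\<And>i. i \<in> {1..Suc n} \<Longrightarrow> (\<lambda>q. fst (V q i)) \<in> borel_measurable M"
    and V2: "\<And>i. i \<in> {1..Suc n} \<Longrightarrow> (\<lambda>q. snd (V q i)) \<in> borel_measurable M"
begin

lemma measurable_left_integrand:
  assumes "(\<lambda>q. X q (Suc n)) \<in> borel_measurable M"
  shows "(\<lambda>q. left_integrand n s p y w (X q) (V q)) \<in> borel_measurable M"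
proof -
  have X': "(\<lambda>q. X q i) \<in> borel_measurable M" if "i \<in> {1..Suc n}" for i
    using that X assms by (cases "i = Suc n") auto
  show ?thesis
    unfolding left_integrand_def left_site_def
    by (intro borel_measurable_times borel_measurable_prod measurable_exp_complex
        measurable_complex_of_real borel_measurable_diff
      borel_measurable_add borel_measurable_sum borel_measurable_const measurable_macdonald_weight
          measurable_rise_coeff measurable_fall_coeff X' V1 V2) auto
qed

lemma measurable_left_reflected: "(\<lambda>q. left_reflected n s p y w (X q) (V q)) \<in> borel_measurable M"
proof -
  have site: "(\<lambda>q. left_reflected_site n s p y w (X q) i (V q i)) \<in> borel_measurable M" if i:
      "i \<in> {1..Suc n}" for i
  proof -
    have first: "(\<lambda>q. if i = 1 then exp (- s * complex_of_real
        (log_sum_exp (fst (V q i)) (snd (V q i)))) else 1) \<in> borel_measurable M"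
      using measurable_log_sum_exp[OF V1[OF i] V2[OF i]]
          by (cases "i = 1"; simp only: if_True if_False simp_thms)
        (intro measurable_exp_complex borel_measurable_times borel_measurable_const
            measurable_complex_of_real; assumption)+
    show ?thesis unfolding left_reflected_site_def
      by (intro borel_measurable_times first measurable_macdonald_weight measurable_rise_coeff
          measurable_fall_coeff measurable_cut_fall_coeff X V1 V2 borel_measurable_const)
        (use i in auto)
  qed
  show ?thesis unfolding left_reflected_def
    by (intro borel_measurable_times borel_measurable_prod site measurable_exp_complex
        measurable_complex_of_real borel_measurable_diff
      borel_measurable_add borel_measurable_sum borel_measurable_const X) auto
qed

lemma measurable_right_reflected: "(\<lambda>q. right_reflected n s p y w (X q) (V q)) \<in> borel_measurable M"
proof -
  have first_log: "(\<lambda>q. first_log n (V q i)) \<in> borel_measurable M" if "i \<in> {1..Suc n}" for i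
    using V1[OF that] V2[OF that] measurable_log_sum_exp
        by (cases "n = 0") (auto simp: first_log_def)
  have site: "(\<lambda>q. right_reflected_site n s p y w (X q) i (V q i)) \<in> borel_measurable M" if i:
      "i \<in> {1..Suc n}" for i
  proof -
    have first: "(\<lambda>q. if i = 1 then exp (- s * complex_of_real (first_log n (V q i))) else 1)
        \<in> borel_measurable M"
      using first_log[OF i] by (cases "i = 1"; simp only: if_True if_False simp_thms)
        (intro measurable_exp_complex borel_measurable_times borel_measurable_const
            measurable_complex_of_real; assumption)+
    show ?thesis unfolding right_reflected_site_def
      by (intro borel_measurable_times first measurable_macdonald_weight measurable_rise_coeff
          measurable_fall_coeff measurable_cut_fall_coeff measurable_cut_rise_coeff X V1 V2
          borel_measurable_const)
        (use i in auto)
  qed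
  show ?thesis unfolding right_reflected_def
    by (intro borel_measurable_times borel_measurable_prod site measurable_exp_complex
        measurable_complex_of_real borel_measurable_diff
      borel_measurable_add borel_measurable_sum borel_measurable_const X) auto
qed

lemma measurable_right_integrand: "(\<lambda>q. right_integrand n s p y w (X q) (V q)) \<in> borel_measurable M"
  unfolding right_integrand_def right_site_def
  by (intro borel_measurable_times borel_measurable_prod measurable_exp_complex
      measurable_complex_of_real borel_measurable_diff
      borel_measurable_add borel_measurable_sum borel_measurable_const measurable_macdonald_weight
          measurable_rise_coeff measurable_fall_coeff measurable_cut_fall_coeff
      measurable_cut_rise_coeff X V1 V2) auto

end

section \<open>Reflecting the pairs (z, u)\<close>

lemma integrable_left_reflected_site:
  assumes "Re s > 0" "Re p > 0" "i \<in> {1..Suc n}"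
  shows "integrable (lborel \<Otimes>\<^sub>M lborel) (left_reflected_site n s p y w x i)"
proof (cases "i = 1")
  case True
  have "left_reflected_site n s p y w x i = boundary_weight s p (fall_coeff n y x i)
      (cut_fall_coeff n x w i)"
    using True by (simp add: fun_eq_iff left_reflected_site_def boundary_weight_def rise_coeff_def)
  then show ?thesis using assms by (auto intro!: integrable_boundary_weight simp: fall_coeff_pos
      cut_fall_coeff_def add_pos_pos)
next
  case False
  then show ?thesis using assms unfolding left_reflected_site_def
    by (simp only: if_False mult_1_left)
       (intro integrable_pair_mult lborel.sigma_finite_measure_axioms integrable_macdonald_weight
           rise_coeff_pos; auto simp: fall_coeff_pos cut_fall_coeff_def add_pos_pos)
qed

text \<open>
  Sites beyond the first factorise into Macdonald integrals in \<open>z\<close> and in \<open>u\<close>; the first one needs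
  the coupled integral. At the last site \<open>u\<close> is translated instead of reflected, which removes its
  coefficient and decouples it. The reflection factor has the same form in all four cases.
\<close>
lemma integral_left_reflected_site:
  fixes y w x :: "nat \<Rightarrow> real" and n i :: nat and s p :: complex
  assumes s: "Re s > 0" and p: "Re p > 0" and i: "i \<in> {1..Suc n}"
  defines "\<kappa> \<equiv> (if i \<le> n then ln (cut_fall_coeff n x w i) else 0) - ln (fall_coeff n y x i)
      + ln (rise_coeff y x i) - ln (rise_coeff x w i)"
  shows "integrable (lborel \<Otimes>\<^sub>M lborel) (right_reflected_site n s p y w x i)"
    and "integral\<^sup>L (lborel \<Otimes>\<^sub>M lborel) (left_reflected_site n s p y w x i)
    = exp (p * complex_of_real \<kappa>) * integral\<^sup>L (lborel \<Otimes>\<^sub>M lborel)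
        (right_reflected_site n s p y w x i)"
proof -
  note sf = lborel.sigma_finite_measure_axioms
  have E: "fall_coeff n y x i > 0" and C: "rise_coeff y x i > 0" and D: "rise_coeff x w i > 0"
    by (rule fall_coeff_pos rise_coeff_pos)+
  have F: "i \<le> n \<Longrightarrow> cut_fall_coeff n x w i > 0" by (simp add: cut_fall_coeff_def add_pos_pos)
  have "integrable (lborel \<Otimes>\<^sub>M lborel) (right_reflected_site n s p y w x i) \<and>
    integral\<^sup>L (lborel \<Otimes>\<^sub>M lborel) (left_reflected_site n s p y w x i)
    = exp (p * complex_of_real \<kappa>) * integral\<^sup>L (lborel \<Otimes>\<^sub>M lborel)
        (right_reflected_site n s p y w x i)"
  proof (cases "i = 1")
    case True
    have G: "left_reflected_site n s p y w x i
        = boundary_weight s p (fall_coeff n y x i) (cut_fall_coeff n x w i)"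
      using True by (simp add: fun_eq_iff left_reflected_site_def boundary_weight_def
          rise_coeff_def)
    show ?thesis
    proof (cases "n = 0")
      case False
      have H: "right_reflected_site n s p y w x i
          = boundary_weight s (- p) (fall_coeff n y x i) (cut_fall_coeff n x w i)"
        using True False by (simp add: fun_eq_iff right_reflected_site_def boundary_weight_def
            rise_coeff_def cut_rise_coeff_def first_log_def)
      show ?thesis
        using integral_boundary_weight_reflect[OF s E F, where p
            = p] integrable_boundary_weight[OF s E, of "cut_fall_coeff n x w i" "- p"] False True F
        unfolding G H by (simp add: \<kappa>_def rise_coeff_def)
    next
      case n: True
      have H: "right_reflected_site n s p y w x i
          = (\<lambda>v. macdonald_weight (p - s) 1 (fall_coeff n y x i) (fst v)
          * macdonald_weight p 1 0 (snd v))"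
        using True n by (simp add: fun_eq_iff right_reflected_site_def rise_coeff_def
            cut_rise_coeff_def first_log_def cut_fall_coeff_def macdonald_weight_def
            exp_add[symmetric] algebra_simps)
      have c0: "cut_fall_coeff n x w i = 0" using n True by (simp add: cut_fall_coeff_def)
      have i1: "integrable lborel (macdonald_weight (p - s) 1 (fall_coeff n y x i))"
          "integrable lborel (macdonald_weight p 1 0)"
        using p by (auto intro!: integrable_macdonald_weight simp: fall_coeff_pos)
      show ?thesis
        using integrable_pair_mult[OF sf sf i1] integral_boundary_weight_zero[OF s E p]
            macdonald_eq_Gamma(2)[OF p] True n
        unfolding G H integral_pair_mult[OF sf sf i1] c0
        by (simp add: \<kappa>_def rise_coeff_def flip: macdonald_def)
    qed
  next
    case i1: False
    have G: "left_reflected_site n s p y w x i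
        = (\<lambda>v. macdonald_weight (- p) (rise_coeff y x i) (fall_coeff n y x i) (fst v)
        * macdonald_weight p (rise_coeff x w i) (cut_fall_coeff n x w i) (snd v))"
      using i1 by (simp add: fun_eq_iff left_reflected_site_def)
    have H: "right_reflected_site n s p y w x i
        = (\<lambda>v. macdonald_weight p (rise_coeff y x i) (fall_coeff n y x i) (fst v)
        * macdonald_weight (if i \<le> n then - p else p) (cut_rise_coeff n x w i)
        (cut_fall_coeff n x w i) (snd v))"
      using i1 by (simp add: fun_eq_iff right_reflected_site_def)
    have ig: "integrable lborel (macdonald_weight (- p) (rise_coeff y x i) (fall_coeff n y x i))"
        "integrable lborel (macdonald_weight p (rise_coeff x w i) (cut_fall_coeff n x w i))"
      using p F by (auto intro!: integrable_macdonald_weight simp: rise_coeff_pos fall_coeff_pos)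
          (auto simp: cut_fall_coeff_def)
    have ih: "integrable lborel (macdonald_weight p (rise_coeff y x i) (fall_coeff n y x i))"
        "integrable lborel (macdonald_weight (if i \<le> n then - p else p) (cut_rise_coeff n x w i)
        (cut_fall_coeff n x w i))"
      using p F by (auto intro!: integrable_macdonald_weight simp: rise_coeff_pos fall_coeff_pos
          cut_rise_coeff_def) (auto simp: cut_fall_coeff_def)
    have z: "macdonald (- p) (rise_coeff y x i) (fall_coeff n y x i)
        = exp (- p * complex_of_real (ln (fall_coeff n y x i) - ln (rise_coeff y x i)))
        * macdonald p (rise_coeff y x i) (fall_coeff n y x i)"
      using macdonald_reflect[OF C E, of "- p"] by simp
    have u: "macdonald p (rise_coeff x w i) (cut_fall_coeff n x w i)
        = exp (p * complex_of_real ((if i \<le> n then ln (cut_fall_coeff n x w i) else 0)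
        - ln (rise_coeff x w i))) *
       macdonald (if i \<le> n then - p else p) (cut_rise_coeff n x w i) (cut_fall_coeff n x w i)"
    proof (cases "i \<le> n")
      case True
      then show ?thesis using macdonald_reflect[OF D F, of p] by (simp add: cut_rise_coeff_def)
    next
      case False
      then show ?thesis using macdonald_zero[OF D p] macdonald_eq_Gamma(2)[OF p]
          by (simp add: cut_rise_coeff_def cut_fall_coeff_def)
    qed
    show ?thesis
      using integrable_pair_mult[OF sf sf ih]
      unfolding G H integral_pair_mult[OF sf sf ig] integral_pair_mult[OF sf sf ih]
          macdonald_def[symmetric]
      by (simp add: z u \<kappa>_def exp_add[symmetric] algebra_simps)
  qed
  then show "integrable (lborel \<Otimes>\<^sub>M lborel) (right_reflected_site n s p y w x i)"
    and "integral\<^sup>L (lborel \<Otimes>\<^sub>M lborel) (left_reflected_site n s p y w x i)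
    = exp (p * complex_of_real \<kappa>) * integral\<^sup>L (lborel \<Otimes>\<^sub>M lborel)
        (right_reflected_site n s p y w x i)"
    by auto
qed

text \<open>
  The reflection factors of the \<open>z\<close>-chain and of the \<open>u\<close>-chain telescope separately, and the
  variables \<open>x\<close>, common to both, cancel.
\<close>
lemma sum_kappa:
  "(\<Sum>i=1..Suc n. (if i \<le> n then ln (cut_fall_coeff n x w i) else 0) - ln (fall_coeff n y x i)
      + ln (rise_coeff y x i) - ln (rise_coeff x w i))
    = (\<Sum>i=1..n. w i) - (\<Sum>i=1..Suc n. y i)"
proof -
  have "(\<Sum>i=1..n. ln (cut_fall_coeff n x w i)) = (\<Sum>i=1..n. ln (fall_coeff n x w i))"
    by (intro sum.cong) (auto simp: cut_fall_coeff_def fall_coeff_def)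
  moreover have "ln (fall_coeff n y x (Suc n)) = y (Suc n)" by (simp add: fall_coeff_def)
  ultimately show ?thesis
    using sum_ln_telescope[of n y x] sum_ln_telescope[of n x w]
    by (simp add: sum.distrib sum_subtractf)
qed

lemma integral_left_reflected:
  assumes s: "Re s > 0" and p: "Re p > 0"
  shows "integrable (lebR2 (Suc n)) (left_reflected n s p y w x)"
    and "(\<integral>v. left_reflected n s p y w x v \<partial>lebR2 (Suc n))
        = (\<integral>v. right_reflected n s p y w x v \<partial>lebR2 (Suc n))"
proof -
  show "integrable (lebR2 (Suc n)) (left_reflected n s p y w x)"
    unfolding left_reflected_def by (intro integrable_sites2 integrable_left_reflected_site s p)
  let ?k = "\<lambda>i. (if i \<le> n then ln (cut_fall_coeff n x w i) else 0) - ln (fall_coeff n y x i)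
      + ln (rise_coeff y x i) - ln (rise_coeff x w i)"
  let ?cG = "exp ((p + s) / 2 * complex_of_real (\<Sum>i=1..Suc n. y i)
      - (p - s) / 2 * complex_of_real (\<Sum>i=1..n. w i) - s * complex_of_real (\<Sum>i=1..n. x i))"
  let ?cH = "exp (- (p - s) / 2 * complex_of_real (\<Sum>i=1..Suc n. y i)
      + (p + s) / 2 * complex_of_real (\<Sum>i=1..n. w i) - s * complex_of_real (\<Sum>i=1..n. x i))"
  let ?M = "lborel \<Otimes>\<^sub>M lborel :: (real \<times> real) measure"
  have "(\<integral>v. left_reflected n s p y w x v \<partial>lebR2 (Suc n)) = ?cG
      * (\<Prod>i=1..Suc n. integral\<^sup>L ?M (left_reflected_site n s p y w x i))"
    unfolding left_reflected_def by (intro integral_sites2 integrable_left_reflected_site s p)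
  also have "(\<Prod>i=1..Suc n. integral\<^sup>L ?M (left_reflected_site n s p y w x i))
     = (\<Prod>i=1..Suc n. exp (p * complex_of_real (?k i))
         * integral\<^sup>L ?M (right_reflected_site n s p y w x i))"
    by (intro prod.cong refl integral_left_reflected_site s p)
  also have "\<dots> = exp (p * complex_of_real (\<Sum>i=1..Suc n. ?k i))
      * (\<Prod>i=1..Suc n. integral\<^sup>L ?M (right_reflected_site n s p y w x i))"
    by (simp only: prod.distrib of_real_sum sum_distrib_left exp_sum finite_atLeastAtMost)
  also have "?cG * (\<dots>) = (?cG * exp (p * complex_of_real (\<Sum>i=1..Suc n. ?k i)))
      * (\<Prod>i=1..Suc n. integral\<^sup>L ?M (right_reflected_site n s p y w x i))"
    by (simp only: mult.assoc)
  also have "?cG * exp (p * complex_of_real (\<Sum>i=1..Suc n. ?k i)) = ?cH"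
    unfolding sum_kappa exp_add[symmetric] by (simp add: field_simps del: sum.cl_ivl_Suc)
  also have "?cH * (\<Prod>i=1..Suc n. integral\<^sup>L ?M (right_reflected_site n s p y w x i))
      = (\<integral>v. right_reflected n s p y w x v \<partial>lebR2 (Suc n))"
    unfolding right_reflected_def by (intro integral_sites2[symmetric]
        integral_left_reflected_site(1) s p)
  finally show "(\<integral>v. left_reflected n s p y w x v \<partial>lebR2 (Suc n))
      = (\<integral>v. right_reflected n s p y w x v \<partial>lebR2 (Suc n))" .
qed

lemma integral_right_integrand:
  assumes s: "Re s > 0" and p: "Re p > 0"
  shows "integrable (lebR2 (Suc n)) (right_integrand n s p y w x)"
    and "(\<integral>v. right_integrand n s p y w x v \<partial>lebR2 (Suc n))
       = Gamma p * (toda_kernel (Suc n) n y x ((p - s) / 2)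
           * toda_kernel n n x w (- ((p + s) / 2)))"
proof -
  note sf = lborel.sigma_finite_measure_axioms
  let ?M = "lborel \<Otimes>\<^sub>M lborel :: (real \<times> real) measure"
  have i1: "integrable lborel (macdonald_weight (p - s) (rise_coeff y x i) (fall_coeff n y x i))"
    "integrable lborel (macdonald_weight (if i \<le> n then - (p + s) else p) (cut_rise_coeff n x w i)
        (cut_fall_coeff n x w i))" for i
    using p by (auto intro!: integrable_macdonald_weight simp: rise_coeff_pos fall_coeff_pos
        cut_fall_coeff_def cut_rise_coeff_def add_pos_pos)
  have iK: "integrable ?M (right_site n s p y w x i)" for i
    unfolding right_site_def by (intro integrable_pair_mult sf i1)
  show "integrable (lebR2 (Suc n)) (right_integrand n s p y w x)"
    unfolding right_integrand_def by (intro integrable_sites2 iK)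
  have K: "integral\<^sup>L ?M (right_site n s p y w x i)
      = macdonald (p - s) (rise_coeff y x i) (fall_coeff n y x i) *
      (if i \<le> n then macdonald (- (p + s)) (rise_coeff x w i) (fall_coeff n x w i) else Gamma p)"
          for i
    unfolding right_site_def integral_pair_mult[OF sf sf i1] macdonald_def[symmetric]
    using macdonald_eq_Gamma(2)[OF p] by (simp add: cut_rise_coeff_def cut_fall_coeff_def
        fall_coeff_def)
  let ?c = "exp (- (p - s) / 2 * complex_of_real (\<Sum>i=1..Suc n. y i)
      + (p + s) / 2 * complex_of_real (\<Sum>i=1..n. w i) + s * complex_of_real (\<Sum>i=1..n. x i))"
  have "(\<integral>v. right_integrand n s p y w x v \<partial>lebR2 (Suc n)) = ?c
      * (\<Prod>i=1..Suc n. integral\<^sup>L ?M (right_site n s p y w x i))"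
    unfolding right_integrand_def by (intro integral_sites2 iK)
  also have "(\<Prod>i=1..Suc n. integral\<^sup>L ?M (right_site n s p y w x i))
     = (\<Prod>i=1..Suc n. macdonald (p - s) (rise_coeff y x i) (fall_coeff n y x i))
         * ((\<Prod>i=1..n. macdonald (- (p + s)) (rise_coeff x w i) (fall_coeff n x w i)) * Gamma p)"
    unfolding K prod.distrib by (simp add: prod.distrib)
  also have "?c * \<dots> = Gamma p * (toda_kernel (Suc n) n y x ((p - s) / 2)
      * toda_kernel n n x w (- ((p + s) / 2)))"
  proof -
    have "?c = exp (- ((p - s) / 2) * complex_of_real ((\<Sum>i=1..Suc n. y i) + (\<Sum>i=1..n. x i)))
       * exp (- (- ((p + s) / 2)) * complex_of_real ((\<Sum>i=1..n. x i) + (\<Sum>i=1..n. w i)))"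
      unfolding exp_add[symmetric] by (simp add: field_simps del: sum.cl_ivl_Suc)
    moreover have "2 * ((p - s) / 2) = p - s" "2 * (- ((p + s) / 2)) = - (p + s)"
        by (simp_all add: field_simps)
    ultimately show ?thesis unfolding toda_kernel_def by (simp only: mult_ac)
  qed
  finally show "(\<integral>v. right_integrand n s p y w x v \<partial>lebR2 (Suc n))
       = Gamma p * (toda_kernel (Suc n) n y x ((p - s) / 2)
           * toda_kernel n n x w (- ((p + s) / 2)))" .
qed

lemma integral_left_integrand:
  assumes s: "Re s > 0" and p: "Re p > 0"
  shows "(\<integral>v. left_integrand n s p y w x v \<partial>lebR2 (Suc n))
       = toda_kernel (Suc n) (Suc n) y x (- ((p + s) / 2))
           * toda_kernel (Suc n) n x w ((p - s) / 2)"
proof -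
  note sf = lborel.sigma_finite_measure_axioms
  let ?M = "lborel \<Otimes>\<^sub>M lborel :: (real \<times> real) measure"
  have i1: "integrable lborel (macdonald_weight (- (p + s)) (rise_coeff y x i)
      (fall_coeff (Suc n) y x i))"
    "integrable lborel (macdonald_weight (p - s) (rise_coeff x w i) (fall_coeff n x w i))" for i
    using p by (auto intro!: integrable_macdonald_weight simp: rise_coeff_pos fall_coeff_pos)
  have iF: "integrable ?M (left_site n s p y w x i)" for i
    unfolding left_site_def by (intro integrable_pair_mult sf i1)
  have F: "integral\<^sup>L ?M (left_site n s p y w x i)
      = macdonald (- (p + s)) (rise_coeff y x i) (fall_coeff (Suc n) y x i) *
      macdonald (p - s) (rise_coeff x w i) (fall_coeff n x w i)" for i
    unfolding left_site_def integral_pair_mult[OF sf sf i1] macdonald_def[symmetric] ..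
  let ?c = "exp ((p + s) / 2 * complex_of_real (\<Sum>i=1..Suc n. y i)
      - (p - s) / 2 * complex_of_real (\<Sum>i=1..n. w i) + s * complex_of_real (\<Sum>i=1..Suc n. x i))"
  have "(\<integral>v. left_integrand n s p y w x v \<partial>lebR2 (Suc n)) = ?c
      * (\<Prod>i=1..Suc n. integral\<^sup>L ?M (left_site n s p y w x i))"
    unfolding left_integrand_def by (intro integral_sites2 iF)
  also have "\<dots> = toda_kernel (Suc n) (Suc n) y x (- ((p + s) / 2))
      * toda_kernel (Suc n) n x w ((p - s) / 2)"
  proof -
    have "?c = exp (- (- ((p + s) / 2)) * complex_of_real ((\<Sum>i=1..Suc n. y i) + (\<Sum>i=1..Suc n. x i)))
       * exp (- ((p - s) / 2) * complex_of_real ((\<Sum>i=1..Suc n. x i) + (\<Sum>i=1..n. w i)))"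
      unfolding exp_add[symmetric] by (simp add: field_simps del: sum.cl_ivl_Suc)
    moreover have "2 * ((p - s) / 2) = p - s" "2 * (- ((p + s) / 2)) = - (p + s)"
        by (simp_all add: field_simps)
    ultimately show ?thesis unfolding toda_kernel_def F prod.distrib by (simp only: mult_ac)
  qed
  finally show ?thesis .
qed

section \<open>Reflecting x\<close>

lemma prod_macdonald_weight_const: "(\<Prod>i\<in>I. macdonald_weight s (A i) (B i) (t i))
    = exp (s * complex_of_real (\<Sum>i\<in>I. t i) - complex_of_real (\<Sum>i\<in>I. A i * exp (t i) + B i
        * exp (- t i)))"
  unfolding prod_macdonald_weight by (simp add: sum_distrib_left)

lemma prod_macdonald_weight_last: "(\<Prod>i=1..Suc n. macdonald_weight (if i
    \<le> n then s else s') (A i) (B i) (t i))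
    = exp (s * complex_of_real (\<Sum>i=1..n. t i) + s' * complex_of_real (t (Suc n))
       - complex_of_real (\<Sum>i=1..Suc n. A i * exp (t i) + B i * exp (- t i)))"
  unfolding prod_macdonald_weight by (simp add: sum_distrib_left)

lemma sum_cut_fall_coeff: "(\<Sum>i=1..Suc n. cut_fall_coeff n x w i * Z i)
    = (\<Sum>i=1..n. (exp (x i) + exp (w i)) * Z i)"
  by (simp add: cut_fall_coeff_def)

lemma sum_cut_rise_coeff: "(\<Sum>i=1..Suc n. cut_rise_coeff n x w i * Z i) = (if n = 0 then 0 else Z 1)
    + (\<Sum>i=1..n. if i < n then (exp (- x i) + exp (- w i)) * Z (Suc i) else 0) + Z (Suc n)"
proof (cases n)
  case (Suc m)
  have "(\<Sum>i=1..Suc n. cut_rise_coeff n x w i * Z i) = (\<Sum>i=1..Suc m. rise_coeff x w i * Z i)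
      + Z (Suc n)"
    using Suc by (simp add: cut_rise_coeff_def)
  then show ?thesis unfolding sum_rise_coeff using Suc by simp
qed (simp add: cut_rise_coeff_def)

text \<open>
  For fixed \<open>(z, u)\<close> the variables \<open>x\<^sub>i\<close> are decoupled as well; these are the coefficients of their
  potentials.
\<close>
definition x_rise :: "(nat \<Rightarrow> real \<times> real) \<Rightarrow> nat \<Rightarrow> real" where
  "x_rise v i = exp (- fst (v i)) + exp (- snd (v i))"

definition x_fall :: "nat \<Rightarrow> (nat \<Rightarrow> real \<times> real) \<Rightarrow> nat \<Rightarrow> real" where
  "x_fall k v i = exp (fst (v (Suc i))) + (if i < k then exp (snd (v (Suc i))) else 0)"

lemma x_rise_pos: "x_rise v i > 0" by (simp add: x_rise_def add_pos_pos)
lemma x_fall_pos: "x_fall k v i > 0" by (simp add: x_fall_def add_pos_nonneg)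

lemma ln_x_rise: "ln (x_rise v i) = log_sum_exp (fst (v i)) (snd (v i)) - fst (v i) - snd (v i)"
proof -
  have "x_rise v i = exp (log_sum_exp (fst (v i)) (snd (v i)) - fst (v i) - snd (v i))"
    unfolding x_rise_def exp_diff exp_log_sum_exp exp_minus by (simp add: field_simps)
  then show ?thesis by simp
qed

lemma ln_x_fall: "ln (x_fall k v i) = (if i < k then log_sum_exp (fst (v (Suc i))) (snd (v (Suc i)))
    else fst (v (Suc i)))"
  by (simp add: x_fall_def log_sum_exp_def)

text \<open>
  The part of the potential that does not involve \<open>x\<close>.
\<close>
definition left_rest :: "nat \<Rightarrow> (nat \<Rightarrow> real) \<Rightarrow> (nat \<Rightarrow> real) \<Rightarrow> (nat \<Rightarrow> real \<times> real) \<Rightarrow> real" where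
  "left_rest n y w v = exp (fst (v 1)) + (\<Sum>i=1..n. exp (- y i) * exp (fst (v (Suc i))))
      + (\<Sum>i=1..Suc n. exp (y i) * exp (- fst (v i)))
    + exp (snd (v 1)) + (\<Sum>i=1..n. exp (- w i) * exp (snd (v (Suc i))))
        + (\<Sum>i=1..n. exp (w i) * exp (- snd (v i)))"

definition right_rest :: "nat \<Rightarrow> (nat \<Rightarrow> real) \<Rightarrow> (nat \<Rightarrow> real) \<Rightarrow> (nat \<Rightarrow> real \<times> real) \<Rightarrow> real" where
  "right_rest n y w v = exp (fst (v 1)) + (\<Sum>i=1..n. exp (- y i) * exp (fst (v (Suc i))))
      + (\<Sum>i=1..Suc n. exp (y i) * exp (- fst (v i)))
    + (if n = 0 then 0 else exp (snd (v 1))) + (\<Sum>i=1..n.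
        if i < n then exp (- w i) * exp (snd (v (Suc i))) else 0)
    + (\<Sum>i=1..n. exp (w i) * exp (- snd (v i))) + exp (snd (v (Suc n)))"

text \<open>
  The same potential, grouped by the sites of \<open>(z, u)\<close> on the left and by those of \<open>x\<close> on the
  right.
\<close>
lemma energy_left: "(\<Sum>i=1..Suc n. rise_coeff y x i * exp (fst (v i)) + fall_coeff (Suc n) y x i
    * exp (- fst (v i)))
    + (\<Sum>i=1..Suc n. rise_coeff x w i * exp (snd (v i)) + fall_coeff n x w i * exp (- snd (v i)))
    = left_rest n y w v + (\<Sum>i=1..Suc n. x_rise v i * exp (x i)
        + (if i \<le> n then x_fall (Suc n) v i else 0) * exp (- x i))"
proof -
  have e: "(\<Sum>i=1..Suc n. (if i \<le> n then x_fall (Suc n) v i else 0) * exp (- x i))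
      = (\<Sum>i=1..n. (exp (fst (v (Suc i))) + exp (snd (v (Suc i)))) * exp (- x i))"
    by (simp add: x_fall_def)
  show ?thesis
    unfolding sum.distrib[of "\<lambda>i. rise_coeff y x i * exp (fst (v i))"] sum.distrib[of
        "\<lambda>i. rise_coeff x w i * exp (snd (v i))"] sum.distrib[of "\<lambda>i. x_rise v i * exp (x i)"]
      sum_rise_coeff sum_fall_coeff sum_fall_coeff_Suc e left_rest_def
    by (simp add: x_rise_def distrib_left distrib_right sum.distrib mult.commute)
qed

lemma energy_left_reflected: "(\<Sum>i=1..Suc n. rise_coeff y x i * exp (fst (v i)) + fall_coeff n y x i
    * exp (- fst (v i)))
    + (\<Sum>i=1..Suc n. rise_coeff x w i * exp (snd (v i)) + cut_fall_coeff n x w i * exp (- snd (v i)))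
    = left_rest n y w v + (\<Sum>i=1..n. x_rise v i * exp (x i) + x_fall (Suc n) v i * exp (- x i))"
proof -
  have e: "(\<Sum>i=1..n. x_fall (Suc n) v i * exp (- x i))
      = (\<Sum>i=1..n. (exp (fst (v (Suc i))) + exp (snd (v (Suc i)))) * exp (- x i))"
    by (simp add: x_fall_def)
  show ?thesis
    unfolding sum.distrib[of "\<lambda>i. rise_coeff y x i * exp (fst (v i))"] sum.distrib[of
        "\<lambda>i. rise_coeff x w i * exp (snd (v i))"] sum.distrib[of "\<lambda>i. x_rise v i * exp (x i)"]
      sum_rise_coeff sum_fall_coeff_Suc sum_cut_fall_coeff e left_rest_def
    by (simp add: x_rise_def distrib_left distrib_right sum.distrib mult.commute)
qed

lemma energy_right: "(\<Sum>i=1..Suc n. rise_coeff y x i * exp (fst (v i)) + fall_coeff n y x i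
    * exp (- fst (v i)))
    + (\<Sum>i=1..Suc n. cut_rise_coeff n x w i * exp (snd (v i)) + cut_fall_coeff n x w i
        * exp (- snd (v i)))
    = right_rest n y w v + (\<Sum>i=1..n. x_rise v i * exp (x i) + x_fall n v i * exp (- x i))"
proof -
  have e: "(\<Sum>i=1..n. x_fall n v i * exp (- x i)) = (\<Sum>i=1..n. exp (fst (v (Suc i))) * exp (- x i))
      + (\<Sum>i=1..n. if i < n then exp (snd (v (Suc i))) * exp (- x i) else 0)"
    unfolding sum.distrib[symmetric] by (intro sum.cong) (auto simp: x_fall_def distrib_right)
  have e2: "(\<Sum>i=1..n. if i < n then (exp (- x i) + exp (- w i)) * exp (snd (v (Suc i))) else 0)
    = (\<Sum>i=1..n. if i < n then exp (snd (v (Suc i))) * exp (- x i) else 0)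
        + (\<Sum>i=1..n. if i < n then exp (- w i) * exp (snd (v (Suc i))) else 0)"
    unfolding sum.distrib[symmetric] by (intro sum.cong) (auto simp: algebra_simps)
  show ?thesis
    unfolding sum.distrib[of "\<lambda>i. rise_coeff y x i * exp (fst (v i))"] sum.distrib[of
        "\<lambda>i. cut_rise_coeff n x w i * exp (snd (v i))"] sum.distrib[of "\<lambda>i. x_rise v i * exp (x i)"]
      sum_rise_coeff sum_fall_coeff_Suc sum_cut_fall_coeff sum_cut_rise_coeff e e2 right_rest_def
    by (simp add: x_rise_def distrib_left distrib_right sum.distrib mult.commute)
qed

lemma left_integrand_eq: "left_integrand n s p y w x v
    = exp ((p + s) / 2 * complex_of_real (\<Sum>i=1..Suc n. y i) - (p - s) / 2
    * complex_of_real (\<Sum>i=1..n. w i)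
     - (p + s) * complex_of_real (\<Sum>i=1..Suc n. fst (v i)) + (p - s)
         * complex_of_real (\<Sum>i=1..Suc n. snd (v i)) - complex_of_real (left_rest n y w v))
     * (\<Prod>i=1..Suc n. macdonald_weight s (x_rise v i) (if i \<le> n then x_fall (Suc n) v i else 0)
         (x i))"
proof -
  have E: "(\<Sum>i=1..Suc n. x_rise v i * exp (x i) + (if i \<le> n then x_fall (Suc n) v i else 0)
      * exp (- x i)) =
     (\<Sum>i=1..Suc n. rise_coeff y x i * exp (fst (v i)) + fall_coeff (Suc n) y x i
         * exp (- fst (v i))) + (\<Sum>i=1..Suc n. rise_coeff x w i * exp (snd (v i))
         + fall_coeff n x w i * exp (- snd (v i))) - left_rest n y w v"
    using energy_left[of y x v n w] by simp
  show ?thesis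
    unfolding left_integrand_def left_site_def prod.distrib prod_macdonald_weight_const E
        exp_add[symmetric] by (simp add: algebra_simps add_divide_distrib diff_divide_distrib del:
        sum.cl_ivl_Suc of_real_sum)
qed

lemma left_reflected_eq: "left_reflected n s p y w x v
    = exp ((p + s) / 2 * complex_of_real (\<Sum>i=1..Suc n. y i) - (p - s) / 2
    * complex_of_real (\<Sum>i=1..n. w i)
     - s * complex_of_real (log_sum_exp (fst (v 1)) (snd (v 1)))
     - p * complex_of_real (\<Sum>i=1..Suc n. fst (v i)) + p * complex_of_real (\<Sum>i=1..Suc n. snd (v i))
         - complex_of_real (left_rest n y w v))
     * (\<Prod>i=1..n. macdonald_weight (- s) (x_rise v i) (x_fall (Suc n) v i) (x i))"
proof -
  have E: "(\<Sum>i=1..n. x_rise v i * exp (x i) + x_fall (Suc n) v i * exp (- x i)) =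
     (\<Sum>i=1..Suc n. rise_coeff y x i * exp (fst (v i)) + fall_coeff n y x i * exp (- fst (v i)))
         + (\<Sum>i=1..Suc n. rise_coeff x w i * exp (snd (v i)) + cut_fall_coeff n x w i
         * exp (- snd (v i))) - left_rest n y w v"
    using energy_left_reflected[of y x v n w] by simp
  have P: "(\<Prod>i=1..Suc n. left_reflected_site n s p y w x i (v i))
      = exp (- s * complex_of_real (log_sum_exp (fst (v 1)) (snd (v 1))))
     * (\<Prod>i=1..Suc n. macdonald_weight (- p) (rise_coeff y x i) (fall_coeff n y x i) (fst (v i))
         * macdonald_weight p (rise_coeff x w i) (cut_fall_coeff n x w i) (snd (v i)))"
    unfolding left_reflected_site_def prod_first[symmetric] by (intro prod.cong) auto
  show ?thesis
    unfolding left_reflected_def P prod.distrib prod_macdonald_weight_const E exp_add[symmetric]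
        by (simp add: algebra_simps add_divide_distrib diff_divide_distrib del: sum.cl_ivl_Suc
        of_real_sum flip: exp_add)
qed

lemma right_reflected_eq: "right_reflected n s p y w x v
    = exp (- (p - s) / 2 * complex_of_real (\<Sum>i=1..Suc n. y i) + (p + s) / 2
    * complex_of_real (\<Sum>i=1..n. w i)
     - s * complex_of_real (first_log n (v 1))
     + p * complex_of_real (\<Sum>i=1..Suc n. fst (v i)) - p * complex_of_real (\<Sum>i=1..n. snd (v i)) + p
         * complex_of_real (snd (v (Suc n)))
     - complex_of_real (right_rest n y w v))
     * (\<Prod>i=1..n. macdonald_weight (- s) (x_rise v i) (x_fall n v i) (x i))"
proof -
  have E: "(\<Sum>i=1..n. x_rise v i * exp (x i) + x_fall n v i * exp (- x i)) =
     (\<Sum>i=1..Suc n. rise_coeff y x i * exp (fst (v i)) + fall_coeff n y x i * exp (- fst (v i)))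
         + (\<Sum>i=1..Suc n. cut_rise_coeff n x w i * exp (snd (v i)) + cut_fall_coeff n x w i
         * exp (- snd (v i))) - right_rest n y w v"
    using energy_right[of y x v n w] by simp
  have P: "(\<Prod>i=1..Suc n. right_reflected_site n s p y w x i (v i))
      = exp (- s * complex_of_real (first_log n (v 1)))
     * (\<Prod>i=1..Suc n. macdonald_weight p (rise_coeff y x i) (fall_coeff n y x i) (fst (v i))
         * macdonald_weight (if i \<le> n then - p else p) (cut_rise_coeff n x w i)
         (cut_fall_coeff n x w i) (snd (v i)))"
    unfolding right_reflected_site_def prod_first[symmetric] by (intro prod.cong) auto
  show ?thesis
    unfolding right_reflected_def P prod.distrib prod_macdonald_weight_const
        prod_macdonald_weight_last E exp_add[symmetric]
        by (simp add: algebra_simps add_divide_distrib diff_divide_distrib del: sum.cl_ivl_Suc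
        of_real_sum flip: exp_add)
qed

lemma right_integrand_eq: "right_integrand n s p y w x v
    = exp (- (p - s) / 2 * complex_of_real (\<Sum>i=1..Suc n. y i) + (p + s) / 2
    * complex_of_real (\<Sum>i=1..n. w i)
     + (p - s) * complex_of_real (\<Sum>i=1..Suc n. fst (v i)) - (p + s)
         * complex_of_real (\<Sum>i=1..n. snd (v i)) + p * complex_of_real (snd (v (Suc n)))
     - complex_of_real (right_rest n y w v))
     * (\<Prod>i=1..n. macdonald_weight s (x_rise v i) (x_fall n v i) (x i))"
proof -
  have E: "(\<Sum>i=1..n. x_rise v i * exp (x i) + x_fall n v i * exp (- x i)) =
     (\<Sum>i=1..Suc n. rise_coeff y x i * exp (fst (v i)) + fall_coeff n y x i * exp (- fst (v i)))
         + (\<Sum>i=1..Suc n. cut_rise_coeff n x w i * exp (snd (v i)) + cut_fall_coeff n x w i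
         * exp (- snd (v i))) - right_rest n y w v"
    using energy_right[of y x v n w] by simp
  show ?thesis
    unfolding right_integrand_def right_site_def prod.distrib prod_macdonald_weight_const
        prod_macdonald_weight_last E exp_add[symmetric]
        by (simp add: algebra_simps add_divide_distrib diff_divide_distrib del: sum.cl_ivl_Suc
        of_real_sum flip: exp_add)
qed

text \<open>
  With \<open>M\<^sub>i = ln (e\<^sup>z\<^sup>i + e\<^sup>u\<^sup>i)\<close> the two coefficients at site \<open>i\<close> have logarithms \<open>M\<^sub>i\<^sub>+\<^sub>1\<close> and \<open>M\<^sub>i - z\<^sub>i
  - u\<^sub>i\<close>, so up to linear terms the sum telescopes to \<open>- M\<^sub>1\<close>: this is the origin of the coupling at
  the first site.
\<close>
lemma sum_ln_x_left:
  "(\<Sum>i=1..n. ln (x_fall (Suc n) v i) - ln (x_rise v i)) - ln (x_rise v (Suc n))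
     = - log_sum_exp (fst (v 1)) (snd (v 1)) + (\<Sum>i=1..Suc n. fst (v i)) + (\<Sum>i=1..Suc n. snd (v i))"
proof -
  let ?M = "\<lambda>i. log_sum_exp (fst (v i)) (snd (v i))"
  have "(\<Sum>i=1..n. ln (x_fall (Suc n) v i) - ln (x_rise v i))
      = (\<Sum>i=1..n. (?M (Suc i) - ?M i) + (fst (v i) + snd (v i)))"
    by (intro sum.cong) (auto simp: ln_x_rise ln_x_fall)
  also have "\<dots> = ?M (Suc n) - ?M 1 + (\<Sum>i=1..n. fst (v i) + snd (v i))"
    unfolding sum.distrib[of "\<lambda>i. ?M (Suc i) - ?M i"] by (subst sum_Suc_diff) auto
  finally show ?thesis by (simp add: ln_x_rise sum.distrib)
qed

lemma sum_ln_x_right: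
  "(\<Sum>i=1..n. ln (x_fall n v i) - ln (x_rise v i))
     = - first_log n (v 1) + (\<Sum>i=1..Suc n. fst (v i)) + (\<Sum>i=1..n. snd (v i))"
proof -
  let ?M = "\<lambda>i. if i \<le> n then log_sum_exp (fst (v i)) (snd (v i)) else fst (v i)"
  have "(\<Sum>i=1..n. ln (x_fall n v i) - ln (x_rise v i))
      = (\<Sum>i=1..n. (?M (Suc i) - ?M i) + (fst (v i) + snd (v i)))"
    by (intro sum.cong) (auto simp: ln_x_rise ln_x_fall)
  also have "\<dots> = ?M (Suc n) - ?M 1 + (\<Sum>i=1..n. fst (v i) + snd (v i))"
    unfolding sum.distrib[of "\<lambda>i. ?M (Suc i) - ?M i"] by (subst sum_Suc_diff) auto
  finally show ?thesis by (auto simp: first_log_def sum.distrib)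
qed

lemma prod_macdonald_reflect:
  assumes "\<And>i. i \<in> I \<Longrightarrow> A i > 0" "\<And>i. i \<in> I \<Longrightarrow> B i > 0" "finite I"
  shows "(\<Prod>i\<in>I. macdonald s (A i) (B i)) = exp (s * complex_of_real (\<Sum>i\<in>I. ln (B i) - ln (A i)))
      * (\<Prod>i\<in>I. macdonald (- s) (A i) (B i))"
proof -
  have "(\<Prod>i\<in>I. macdonald s (A i) (B i)) = (\<Prod>i\<in>I. exp (s * complex_of_real (ln (B i) - ln (A i)))
      * macdonald (- s) (A i) (B i))"
    by (intro prod.cong refl macdonald_reflect assms)
  then show ?thesis using assms(3) by (simp only: prod.distrib of_real_sum sum_distrib_left exp_sum)
qed

lemma integrable_left_integrand:
  assumes "Re s > 0" shows "integrable (lebR (Suc n)) (\<lambda>x. left_integrand n s p y w x v)"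
  unfolding left_integrand_eq using assms by (intro integrable_sites integrable_macdonald_weight
      x_rise_pos) (auto simp: x_fall_pos)

lemma integrable_right_reflected: "integrable (lebR n) (\<lambda>x. right_reflected n s p y w x v)"
  unfolding right_reflected_eq by (intro integrable_sites integrable_macdonald_weight x_rise_pos)
      (auto simp: x_fall_pos)

text \<open>
  The last \<open>x\<close> has no barrier at \<open>- \<infinity>\<close> and gives \<open>\<Gamma> s\<close>; all others are reflected.
\<close>
lemma integral_left_integrand_left_reflected:
  assumes s: "Re s > 0"
  shows "(\<integral>x. left_integrand n s p y w x v \<partial>lebR (Suc n)) = Gamma s
      * (\<integral>x. left_reflected n s p y w x v \<partial>lebR n)"
proof -
  let ?f = "exp ((p + s) / 2 * complex_of_real (\<Sum>i=1..Suc n. y i) - (p - s) / 2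
      * complex_of_real (\<Sum>i=1..n. w i)
     - (p + s) * complex_of_real (\<Sum>i=1..Suc n. fst (v i)) + (p - s)
         * complex_of_real (\<Sum>i=1..Suc n. snd (v i)) - complex_of_real (left_rest n y w v))"
  let ?g = "exp ((p + s) / 2 * complex_of_real (\<Sum>i=1..Suc n. y i) - (p - s) / 2
      * complex_of_real (\<Sum>i=1..n. w i)
     - s * complex_of_real (log_sum_exp (fst (v 1)) (snd (v 1)))
     - p * complex_of_real (\<Sum>i=1..Suc n. fst (v i)) + p * complex_of_real (\<Sum>i=1..Suc n. snd (v i))
         - complex_of_real (left_rest n y w v))"
  let ?S = "\<Sum>i=1..n. ln (x_fall (Suc n) v i) - ln (x_rise v i)"
  have "(\<integral>x. left_integrand n s p y w x v \<partial>lebR (Suc n)) = ?f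
      * (\<Prod>i=1..Suc n. macdonald s (x_rise v i) (if i \<le> n then x_fall (Suc n) v i else 0))"
    unfolding left_integrand_eq macdonald_def using s
        by (intro integral_sites integrable_macdonald_weight x_rise_pos) (auto simp: x_fall_pos)
  also have "(\<Prod>i=1..Suc n. macdonald s (x_rise v i) (if i \<le> n then x_fall (Suc n) v i else 0))
     = (\<Prod>i=1..n. macdonald s (x_rise v i) (x_fall (Suc n) v i)) * macdonald s (x_rise v (Suc n)) 0"
    by simp
  also have "\<dots> = (exp (s * complex_of_real ?S)
      * (\<Prod>i=1..n. macdonald (- s) (x_rise v i) (x_fall (Suc n) v i)))
     * (exp (- s * complex_of_real (ln (x_rise v (Suc n)))) * Gamma s)"
    by (subst prod_macdonald_reflect) (auto simp: macdonald_zero x_rise_pos x_fall_pos s)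
  also have "?f * \<dots> = Gamma s * ((?f * exp (s * complex_of_real ?S)
      * exp (- s * complex_of_real (ln (x_rise v (Suc n)))))
      * (\<Prod>i=1..n. macdonald (- s) (x_rise v i) (x_fall (Suc n) v i)))"
    by (simp only: mult_ac)
  also have "?f * exp (s * complex_of_real ?S) * exp (- s * complex_of_real (ln (x_rise v (Suc n))))
      = ?f * exp (s * complex_of_real (?S - ln (x_rise v (Suc n))))"
    unfolding exp_add[symmetric] by (simp add: algebra_simps)
  also have "\<dots> = ?g"
    unfolding sum_ln_x_left exp_add[symmetric]
        by (simp add: algebra_simps add_divide_distrib diff_divide_distrib del: sum.cl_ivl_Suc
        of_real_sum)
  also have "?g * (\<Prod>i=1..n. macdonald (- s) (x_rise v i) (x_fall (Suc n) v i))
      = (\<integral>x. left_reflected n s p y w x v \<partial>lebR n)"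
    unfolding left_reflected_eq macdonald_def
        by (intro integral_sites[symmetric] integrable_macdonald_weight x_rise_pos)
        (auto simp: x_fall_pos)
  finally show ?thesis .
qed

lemma integral_right_reflected_right_integrand:
  "(\<integral>x. right_reflected n s p y w x v \<partial>lebR n) = (\<integral>x. right_integrand n s p y w x v \<partial>lebR n)"
proof -
  let ?h = "exp (- (p - s) / 2 * complex_of_real (\<Sum>i=1..Suc n. y i) + (p + s) / 2
      * complex_of_real (\<Sum>i=1..n. w i)
     - s * complex_of_real (first_log n (v 1))
     + p * complex_of_real (\<Sum>i=1..Suc n. fst (v i)) - p * complex_of_real (\<Sum>i=1..n. snd (v i)) + p
         * complex_of_real (snd (v (Suc n)))
     - complex_of_real (right_rest n y w v))"
  let ?k = "exp (- (p - s) / 2 * complex_of_real (\<Sum>i=1..Suc n. y i) + (p + s) / 2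
      * complex_of_real (\<Sum>i=1..n. w i)
     + (p - s) * complex_of_real (\<Sum>i=1..Suc n. fst (v i)) - (p + s)
         * complex_of_real (\<Sum>i=1..n. snd (v i)) + p * complex_of_real (snd (v (Suc n)))
     - complex_of_real (right_rest n y w v))"
  let ?S = "\<Sum>i=1..n. ln (x_fall n v i) - ln (x_rise v i)"
  have "(\<integral>x. right_integrand n s p y w x v \<partial>lebR n) = ?k
      * (\<Prod>i=1..n. macdonald s (x_rise v i) (x_fall n v i))"
    unfolding right_integrand_eq macdonald_def
        by (intro integral_sites integrable_macdonald_weight x_rise_pos) (auto simp: x_fall_pos)
  also have "\<dots> = (?k * exp (s * complex_of_real ?S))
      * (\<Prod>i=1..n. macdonald (- s) (x_rise v i) (x_fall n v i))"
    by (subst prod_macdonald_reflect) (auto simp: x_rise_pos x_fall_pos)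
  also have "?k * exp (s * complex_of_real ?S) = ?h"
    unfolding sum_ln_x_right exp_add[symmetric]
        by (simp add: algebra_simps add_divide_distrib diff_divide_distrib del: sum.cl_ivl_Suc
        of_real_sum)
  also have "?h * (\<Prod>i=1..n. macdonald (- s) (x_rise v i) (x_fall n v i))
      = (\<integral>x. right_reflected n s p y w x v \<partial>lebR n)"
    unfolding right_reflected_eq macdonald_def
        by (intro integral_sites[symmetric] integrable_macdonald_weight x_rise_pos)
        (auto simp: x_fall_pos)
  finally show ?thesis ..
qed

section \<open>The exchange relation\<close>

lemma measurable_lebR_component: "i \<in> {1..n} \<Longrightarrow> (\<lambda>x. x i) \<in> borel_measurable (lebR n)"
  using measurable_component_singleton[of i "{1..n}" "\<lambda>_. lborel :: real measure"] by simp

lemma measurable_lebR2_component: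
  assumes "i \<in> {1..n}"
  shows "(\<lambda>v. fst (v i)) \<in> borel_measurable (lebR2 n)"
      "(\<lambda>v. snd (v i)) \<in> borel_measurable (lebR2 n)"
  using measurable_component_singleton[OF assms, of "\<lambda>_. lborel \<Otimes>\<^sub>M lborel :: (real \<times> real) measure"]
  by (auto dest: measurable_fst' measurable_snd' simp: o_def)

lemma measurable_pair_component:
  assumes "i \<in> {1..k}"
  shows "(\<lambda>q. fst q i) \<in> borel_measurable (lebR k \<Otimes>\<^sub>M N)"
    and "(\<lambda>q. snd q i) \<in> borel_measurable (N \<Otimes>\<^sub>M lebR k)"
  by (rule measurable_compose[OF measurable_fst measurable_lebR_component[OF assms]])
    (rule measurable_compose[OF measurable_snd measurable_lebR_component[OF assms]])

lemma measurable_pair_component2: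
  assumes "i \<in> {1..k}"
  shows "(\<lambda>q. fst (fst q i)) \<in> borel_measurable (lebR2 k \<Otimes>\<^sub>M N)"
    and "(\<lambda>q. snd (fst q i)) \<in> borel_measurable (lebR2 k \<Otimes>\<^sub>M N)"
    and "(\<lambda>q. fst (snd q i)) \<in> borel_measurable (N \<Otimes>\<^sub>M lebR2 k)"
    and "(\<lambda>q. snd (snd q i)) \<in> borel_measurable (N \<Otimes>\<^sub>M lebR2 k)"
  by (rule measurable_compose[OF measurable_fst] measurable_compose[OF measurable_snd],
      rule measurable_lebR2_component[OF assms])+

lemma integrable_exp_sum_abs: "integrable (lebR n) (\<lambda>x. exp (- (\<Sum>i=1..n. \<bar>x i\<bar>)))"
proof -
  have "integrable (lebR n) (\<lambda>x. \<Prod>i=1..n. exp (- \<bar>x i\<bar>))"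
    using lborel_sites.product_integrable_prod[of "{1..n}"
        "\<lambda>_ t. exp (- \<bar>t\<bar>)"] integrable_exp_minus_abs by simp
  then show ?thesis by (simp add: exp_sum flip: sum_negf)
qed

text \<open>
  The decay of the kernel beats any exponential growth of \<open>f\<close>, and growth in \<open>y\<close> stays at most
  exponential, so the bound can be iterated.
\<close>
lemma toda_kernel_integral_bound:
  assumes f: "f \<in> borel_measurable (lebR n)" and le:
      "\<And>x. norm (f x) \<le> C * exp (N * (\<Sum>i=1..n. \<bar>x i\<bar>))" and N: "N \<ge> 0"
  shows "integrable (lebR n) (\<lambda>x. toda_kernel (Suc n) n y x c * f x)"
    and "\<exists>C'\<ge>0. \<exists>N'\<ge>0. \<forall>y. norm (\<integral>x. toda_kernel (Suc n) n y x c * f x \<partial>lebR n) \<le> C'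
        * exp (N' * (\<Sum>i=1..Suc n. \<bar>y i\<bar>))"
proof -
  have C: "C \<ge> 0" using order_trans[OF norm_ge_zero le[of undefined]]
      by (simp add: zero_le_mult_iff)
  \<comment> \<open>Of the decay, \<open>\<bar>Re c\<bar>\<close> pays for the exponential prefactor, \<open>N\<close> for \<open>f\<close>, and \<open>1\<close> is left
      for convergence.\<close>
  obtain D M where D: "D \<ge> 0" and M: "M \<ge> 0" and kb:
      "\<And>y x. norm (toda_kernel (Suc n) n y x c) \<le> D * exp (M * (\<Sum>i=1..Suc n. \<bar>y i\<bar>)
     + \<bar>Re c\<bar> * (\<Sum>i=1..n. \<bar>x i\<bar>) - (\<bar>Re c\<bar> + N + 1) * (\<Sum>i=1..n. \<bar>x i\<bar>))"
    using toda_kernel_bound[of "\<bar>Re c\<bar> + N + 1" n "Suc n" c] N by fastforce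
  have meas: "(\<lambda>x. toda_kernel (Suc n) n y x c * f x) \<in> borel_measurable (lebR n)" for y
    by (intro borel_measurable_times f measurable_toda_kernel)
        (auto intro: measurable_lebR_component)
  have b: "norm (toda_kernel (Suc n) n y x c * f x) \<le> C * D * exp (M * (\<Sum>i=1..Suc n. \<bar>y i\<bar>))
      * exp (- (\<Sum>i=1..n. \<bar>x i\<bar>))" for y x
  proof -
    have "norm (toda_kernel (Suc n) n y x c * f x) \<le> D * exp (M * (\<Sum>i=1..Suc n. \<bar>y i\<bar>)
     + \<bar>Re c\<bar> * (\<Sum>i=1..n. \<bar>x i\<bar>) - (\<bar>Re c\<bar> + N + 1) * (\<Sum>i=1..n. \<bar>x i\<bar>))
         * (C * exp (N * (\<Sum>i=1..n. \<bar>x i\<bar>)))"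
      unfolding norm_mult using D by (intro mult_mono kb le) auto
    also have "\<dots> = C * D * exp (M * (\<Sum>i=1..Suc n. \<bar>y i\<bar>)) * exp (- (\<Sum>i=1..n. \<bar>x i\<bar>))"
      by (simp add: algebra_simps del: sum.cl_ivl_Suc flip: exp_add)
    finally show ?thesis .
  qed
  have bi: "integrable (lebR n) (\<lambda>x. C * D * exp (M * (\<Sum>i=1..Suc n. \<bar>y i\<bar>))
      * exp (- (\<Sum>i=1..n. \<bar>x i\<bar>)))" for y
    using integrable_exp_sum_abs[of n] by simp
  have int: "integrable (lebR n) (\<lambda>x. toda_kernel (Suc n) n y x c * f x)" for y
    by (rule Bochner_Integration.integrable_bound[OF bi[of y] meas])
        (intro AE_I2 order_trans[OF b]; simp)
  then show "integrable (lebR n) (\<lambda>x. toda_kernel (Suc n) n y x c * f x)" .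
  let ?J = "\<integral>x. exp (- (\<Sum>i=1..n. \<bar>x i\<bar>)) \<partial>lebR n"
  have "norm (\<integral>x. toda_kernel (Suc n) n y x c * f x \<partial>lebR n) \<le> C * D * ?J
      * exp (M * (\<Sum>i=1..Suc n. \<bar>y i\<bar>))" for y
  proof -
    have "norm (\<integral>x. toda_kernel (Suc n) n y x c * f x \<partial>lebR n)
        \<le> (\<integral>x. norm (toda_kernel (Suc n) n y x c * f x) \<partial>lebR n)"
      by (rule integral_norm_bound)
    also have "\<dots> \<le> (\<integral>x. C * D * exp (M * (\<Sum>i=1..Suc n. \<bar>y i\<bar>)) * exp (- (\<Sum>i=1..n. \<bar>x i\<bar>)) \<partial>lebR n)"
      by (intro integral_mono integrable_norm int bi b)
    finally show ?thesis by (simp add: mult_ac)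
  qed
  moreover have "C * D * ?J \<ge> 0" using C D by simp
  ultimately show "\<exists>C'\<ge>0. \<exists>N'\<ge>0. \<forall>y. norm (\<integral>x. toda_kernel (Suc n) n y x c * f x \<partial>lebR n) \<le> C'
      * exp (N' * (\<Sum>i=1..Suc n. \<bar>y i\<bar>))"
    using M by blast
qed

lemma norm_toda_kernel_le_Re: "norm (toda_kernel l m y x s)
    \<le> norm (toda_kernel l m y x (complex_of_real (Re s)))"
proof -
  have "norm (\<Prod>i=1..l. macdonald (2 * s) (rise_coeff y x i) (fall_coeff m y x i))
      \<le> norm (\<Prod>i=1..l. macdonald (2 * complex_of_real (Re s)) (rise_coeff y x i)
      (fall_coeff m y x i))"
    unfolding prod_norm[symmetric] using norm_macdonald_le_Re[of "2 * s"] by (intro prod_mono) auto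
  then show ?thesis unfolding toda_kernel_def norm_mult
      by (intro mult_mono) (auto simp: norm_exp_eq_Re)
qed

lemma of_real_norm_toda_kernel: "complex_of_real (norm (toda_kernel l m y x (complex_of_real r)))
    = toda_kernel l m y x (complex_of_real r)"
proof -
  have "complex_of_real (norm (macdonald (2 * complex_of_real r) A B))
      = macdonald (2 * complex_of_real r) A B" for A B
    using norm_macdonald_of_real[of "2 * r" A B] by simp
  then show ?thesis
    unfolding toda_kernel_def norm_mult of_real_mult prod_norm[symmetric] of_real_prod
        of_real_norm_exp by simp
qed

lemma integrable_toda_kernel_toda_kernel: "integrable (lebR n) (\<lambda>x. toda_kernel (Suc n) n y x c
    * toda_kernel n n x w d)"
proof -
  obtain C N where C: "C \<ge> 0" and N: "N \<ge> 0" and kb: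
      "\<And>y x. norm (toda_kernel n n y x d) \<le> C
      * exp (N * (\<Sum>i=1..n. \<bar>y i\<bar>) + \<bar>Re d\<bar> * (\<Sum>i=1..n. \<bar>x i\<bar>))"
    using toda_kernel_bound[of 0 n n d] by fastforce
  have le: "norm (toda_kernel n n x w d) \<le> C * exp (\<bar>Re d\<bar> * (\<Sum>i=1..n. \<bar>w i\<bar>))
      * exp (N * (\<Sum>i=1..n. \<bar>x i\<bar>))" for x
    using kb[of x w] by (simp add: exp_add mult_ac)
  show ?thesis
    by (rule toda_kernel_integral_bound(1)[OF _ le N], rule measurable_toda_kernel)
        (auto intro: measurable_lebR_component)
qed

text \<open>
  Read from the right-hand side, whose integrability is known, the chain passes through the four
  integrands with the inner variable alternating between \<open>x\<close> and \<open>(z, u)\<close>.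
\<close>
lemma toda_kernel_exchange:
  fixes s p :: complex
  assumes s: "Re s > 0" and p: "Re p > 0"
  shows "integrable (lebR (Suc n)) (\<lambda>x. toda_kernel (Suc n) (Suc n) y x (- ((p + s) / 2))
      * toda_kernel (Suc n) n x w ((p - s) / 2))"
    and "(\<integral>x. toda_kernel (Suc n) (Suc n) y x (- ((p + s) / 2))
        * toda_kernel (Suc n) n x w ((p - s) / 2) \<partial>lebR (Suc n))
     = Gamma s * Gamma p * (\<integral>x. toda_kernel (Suc n) n y x ((p - s) / 2)
         * toda_kernel n n x w (- ((p + s) / 2)) \<partial>lebR n)"
proof -
  let ?X = "lebR n" and ?X' = "lebR (Suc n)" and ?V = "lebR2 (Suc n)"
  note sf = sigma_finite_lebR[of n] sigma_finite_lebR[of "Suc n"] sigma_finite_lebR2[of "Suc n"]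
  interpret XV: pair_sigma_finite ?X ?V using sf by (simp add: pair_sigma_finite_def)
  interpret VX': pair_sigma_finite ?V ?X' using sf by (simp add: pair_sigma_finite_def)
  have normK: "(\<integral>v. norm (right_integrand n s p y w x v) \<partial>?V)
      = norm (Gamma (complex_of_real (Re p)) * (toda_kernel (Suc n) n y x (((Re p) - (Re s)) / 2)
      * toda_kernel n n x w (- (((Re p) + (Re s)) / 2))))" for x
  proof -
    have "complex_of_real (\<integral>v. norm (right_integrand n s p y w x v) \<partial>?V)
        = (\<integral>v. right_integrand n (Re s) (Re p) y w x v \<partial>?V)"
      unfolding of_real_norm_right_integrand[symmetric] by simp
    also have "\<dots> = Gamma (complex_of_real (Re p))
        * (toda_kernel (Suc n) n y x (((Re p) - (Re s)) / 2)
        * toda_kernel n n x w (- (((Re p) + (Re s)) / 2)))"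
      using integral_right_integrand(2)[of "complex_of_real (Re s)"
          "complex_of_real (Re p)" n y w x] s p by simp
    finally have *: "complex_of_real (\<integral>v. norm (right_integrand n s p y w x v) \<partial>?V) = \<dots>" .
    show ?thesis unfolding *[symmetric] by simp
  qed
  have K: "integrable (?X \<Otimes>\<^sub>M ?V) (\<lambda>q. right_integrand n s p y w (fst q) (snd q))"
  proof (rule XV.Fubini_integrable)
    show "(\<lambda>q. right_integrand n s p y w (fst q) (snd q)) \<in> borel_measurable (?X \<Otimes>\<^sub>M ?V)"
      by (intro measurable_right_integrand measurable_pair_component measurable_pair_component2)
    show "integrable ?X (\<lambda>x. \<integral>v. norm (right_integrand n s p y w (fst (x, v)) (snd (x, v))) \<partial>?V)"
      unfolding fst_conv snd_conv normK by (intro integrable_norm integrable_mult_right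
          integrable_toda_kernel_toda_kernel)
    show "AE x in ?X. integrable ?V (\<lambda>v. right_integrand n s p y w (fst (x, v)) (snd (x, v)))"
      using integral_right_integrand(1)[OF s p] by simp
  qed
  have H: "integrable (?V \<Otimes>\<^sub>M ?X) (\<lambda>q. right_reflected n s p y w (snd q) (fst q))"
  proof (rule fubini_integrable_transfer[OF sf(3,1,1), where f
      = "\<lambda>v x. right_reflected n s p y w x v" and g = "\<lambda>v x. right_integrand n s p y w x v"])
    show "(\<lambda>q. right_reflected n s p y w (snd q) (fst q)) \<in> borel_measurable (?V \<Otimes>\<^sub>M ?X)"
      by (intro measurable_right_reflected measurable_pair_component measurable_pair_component2)
    show "(\<integral>x. norm (right_reflected n s p y w x v) \<partial>?X) \<le> norm (1::complex)
        * (\<integral>x. norm (right_integrand n s p y w x v) \<partial>?X)" for v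
      by (rule norm_transfer[where c = "\<lambda>_ _. 1" and f = "\<lambda>s p x. right_reflected n s p y w x v"
          and g = "\<lambda>s p x. right_integrand n s p y w x v"])
         (use integral_right_reflected_right_integrand in \<open>simp_all add:
             of_real_norm_right_reflected of_real_norm_right_integrand s p\<close>)
  qed (use K integrable_right_reflected in auto)
  have HK: "(\<integral>q. right_reflected n s p y w (snd q) (fst q) \<partial>(?V \<Otimes>\<^sub>M ?X)) = 1
      * (\<integral>q. right_integrand n s p y w (fst q) (snd q) \<partial>(?X \<Otimes>\<^sub>M ?V))"
    by (intro fubini_integral_eq[OF sf(3,1,1), where f = "\<lambda>v x. right_reflected n s p y w x v"
        and g = "\<lambda>v x. right_integrand n s p y w x v"])
      (use H K integral_right_reflected_right_integrand in simp_all)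
  have G: "integrable (?X \<Otimes>\<^sub>M ?V) (\<lambda>q. left_reflected n s p y w (fst q) (snd q))"
  proof (rule fubini_integrable_transfer[OF sf(1,3,3), where f
      = "\<lambda>x v. left_reflected n s p y w x v" and g = "\<lambda>x v. right_reflected n s p y w x v"])
    show "(\<lambda>q. left_reflected n s p y w (fst q) (snd q)) \<in> borel_measurable (?X \<Otimes>\<^sub>M ?V)"
      by (intro measurable_left_reflected measurable_pair_component measurable_pair_component2)
    show "(\<integral>v. norm (left_reflected n s p y w x v) \<partial>?V) \<le> norm (1::complex)
        * (\<integral>v. norm (right_reflected n s p y w x v) \<partial>?V)" for x
      by (rule norm_transfer[where c = "\<lambda>_ _. 1" and f = "\<lambda>s p v. left_reflected n s p y w x v"
          and g = "\<lambda>s p v. right_reflected n s p y w x v"])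
         (use integral_left_reflected(2) in \<open>simp_all add: of_real_norm_right_reflected
             of_real_norm_left_reflected s p\<close>)
  qed (use H integral_left_reflected(1)[OF s p] in auto)
  have GH: "(\<integral>q. left_reflected n s p y w (fst q) (snd q) \<partial>(?X \<Otimes>\<^sub>M ?V)) = 1
      * (\<integral>q. right_reflected n s p y w (snd q) (fst q) \<partial>(?V \<Otimes>\<^sub>M ?X))"
    by (intro fubini_integral_eq[OF sf(1,3,3), where f = "\<lambda>x v. left_reflected n s p y w x v"
        and g = "\<lambda>x v. right_reflected n s p y w x v"])
      (use H G integral_left_reflected(2)[OF s p] in simp_all)
  have F: "integrable (?V \<Otimes>\<^sub>M ?X') (\<lambda>q. left_integrand n s p y w (snd q) (fst q))"
  proof (rule fubini_integrable_transfer[OF sf(3,2,1), where f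
      = "\<lambda>v x. left_integrand n s p y w x v" and g = "\<lambda>v x. left_reflected n s p y w x v"])
    show "(\<lambda>q. left_integrand n s p y w (snd q) (fst q)) \<in> borel_measurable (?V \<Otimes>\<^sub>M ?X')"
      by (intro measurable_left_integrand measurable_pair_component measurable_pair_component2) auto
    show "(\<integral>x. norm (left_integrand n s p y w x v) \<partial>?X') \<le> norm (Gamma (complex_of_real (Re s)))
        * (\<integral>x. norm (left_reflected n s p y w x v) \<partial>?X)" for v
      by (rule norm_transfer[where c = "\<lambda>s p. Gamma s"
          and f = "\<lambda>s p x. left_integrand n s p y w x v"
          and g = "\<lambda>s p x. left_reflected n s p y w x v"])
         (use integral_left_integrand_left_reflected in \<open>simp_all add: of_real_norm_left_integrand
             of_real_norm_left_reflected s p\<close>)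
  qed (use G integrable_left_integrand s in auto)
  have FG: "(\<integral>q. left_integrand n s p y w (snd q) (fst q) \<partial>(?V \<Otimes>\<^sub>M ?X')) = Gamma s
      * (\<integral>q. left_reflected n s p y w (fst q) (snd q) \<partial>(?X \<Otimes>\<^sub>M ?V))"
    by (intro fubini_integral_eq[OF sf(3,2,1), where f = "\<lambda>v x. left_integrand n s p y w x v"
        and g = "\<lambda>v x. left_reflected n s p y w x v"])
      (use F G integral_left_integrand_left_reflected[OF s] in simp_all)
  have F': "integrable (?V \<Otimes>\<^sub>M ?X') (\<lambda>(v, x). left_integrand n s p y w x v)"
    using F by (simp add: case_prod_beta')
  show "integrable ?X' (\<lambda>x. toda_kernel (Suc n) (Suc n) y x (- ((p + s) / 2))
      * toda_kernel (Suc n) n x w ((p - s) / 2))"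
    using VX'.integrable_snd[OF F'] unfolding integral_left_integrand[OF s p] .
  have "(\<integral>x. toda_kernel (Suc n) (Suc n) y x (- ((p + s) / 2))
      * toda_kernel (Suc n) n x w ((p - s) / 2) \<partial>?X')
      = (\<integral>q. left_integrand n s p y w (snd q) (fst q) \<partial>(?V \<Otimes>\<^sub>M ?X'))"
    using VX'.integral_snd[OF F'] unfolding integral_left_integrand[OF s p]
        by (simp add: case_prod_beta')
  also have "\<dots> = Gamma s * (\<integral>q. right_integrand n s p y w (fst q) (snd q) \<partial>(?X \<Otimes>\<^sub>M ?V))"
    using FG GH HK by simp
  also have "(\<integral>q. right_integrand n s p y w (fst q) (snd q) \<partial>(?X \<Otimes>\<^sub>M ?V)) =
      Gamma p * (\<integral>x. toda_kernel (Suc n) n y x ((p - s) / 2)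
          * toda_kernel n n x w (- ((p + s) / 2)) \<partial>?X)"
    using XV.integral_fst'[OF K] unfolding fst_conv snd_conv integral_right_integrand(2)[OF s p]
        integral_mult_right_zero by simp
  finally show "(\<integral>x. toda_kernel (Suc n) (Suc n) y x (- ((p + s) / 2))
      * toda_kernel (Suc n) n x w ((p - s) / 2) \<partial>?X')
     = Gamma s * Gamma p * (\<integral>x. toda_kernel (Suc n) n y x ((p - s) / 2)
         * toda_kernel n n x w (- ((p + s) / 2)) \<partial>?X)"
    by (simp add: mult.assoc)
qed

section \<open>Whittaker functions as eigenfunctions\<close>

lemma whittaker_Suc_toda_kernel: "whittaker (Suc n) lam x
    = (\<integral>w. toda_kernel (Suc n) n x w (\<i> * lam (Suc n)) * whittaker n lam w \<partial>lebR n)"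
  by (simp add: recursive_kernel_eq_toda_kernel)

declare whittaker.simps(2) [simp del]

lemma measurable_whittaker: "whittaker n lam \<in> borel_measurable (lebR n)"
proof (induction n)
  case (Suc n)
  interpret sigma_finite_measure "lebR n" by (rule sigma_finite_lebR)
  have "(\<lambda>v. toda_kernel (Suc n) n (fst v) (snd v) (\<i> * lam (Suc n)) * whittaker n lam (snd v))
      \<in> borel_measurable (lebR (Suc n) \<Otimes>\<^sub>M lebR n)"
    by (intro borel_measurable_times measurable_compose[OF measurable_snd Suc.IH]
        measurable_toda_kernel
        measurable_compose[OF measurable_snd measurable_lebR_component]
        measurable_compose[OF measurable_fst measurable_lebR_component]) auto
  then show ?case
    unfolding whittaker_Suc_toda_kernel[abs_def]
        by (intro borel_measurable_lebesgue_integral) (simp add: case_prod_beta')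
qed (simp add: whittaker.simps(1)[abs_def])

lemma whittaker_bound: "\<exists>C\<ge>0. \<exists>N\<ge>0. \<forall>x. norm (whittaker n lam x) \<le> C * exp (N * (\<Sum>i=1..n. \<bar>x i\<bar>))"
proof (induction n)
  case 0
  show ?case by (rule exI[of _ 1]) (auto intro!: exI[of _ 0])
next
  case (Suc n)
  then obtain C N where "C \<ge> 0" "N \<ge> 0" and le:
      "\<And>x. norm (whittaker n lam x) \<le> C * exp (N * (\<Sum>i=1..n. \<bar>x i\<bar>))" by blast
  then show ?case unfolding whittaker_Suc_toda_kernel
    by (intro toda_kernel_integral_bound(2) measurable_whittaker)
qed

lemma integrable_whittaker: "integrable (lebR n) (\<lambda>w. toda_kernel (Suc n) n y w c
    * (d * whittaker n lam w))"
proof -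
  obtain C N where "C \<ge> 0" "N \<ge> 0" and le: "\<And>x. norm (whittaker n lam x) \<le> C
      * exp (N * (\<Sum>i=1..n. \<bar>x i\<bar>))"
    using whittaker_bound by blast
  then have "integrable (lebR n) (\<lambda>w. toda_kernel (Suc n) n y w c * whittaker n lam w)"
    by (intro toda_kernel_integral_bound(1) measurable_whittaker)
  then have "integrable (lebR n) (\<lambda>w. d * (toda_kernel (Suc n) n y w c * whittaker n lam w))"
      by simp
  then show ?thesis by (simp add: mult_ac)
qed

text \<open>
  The spectral parameters that have the same convergence properties as \<open>\<lambda>\<close> but make every
  integrand positive, since \<open>\<i> \<lambda>\<close> becomes real.
\<close>
definition imag_part :: "(nat \<Rightarrow> complex) \<Rightarrow> nat \<Rightarrow> complex" where
  "imag_part lam i = \<i> * complex_of_real (Im (lam i))"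

lemma i_imag_part: "\<i> * imag_part lam i = complex_of_real (Re (\<i> * lam i))"
  by (simp add: imag_part_def flip: mult.assoc)

lemma of_real_norm_whittaker:
  "complex_of_real (norm (whittaker n (imag_part lam) x)) = whittaker n (imag_part lam) x"
proof (induction n arbitrary: x)
  case (Suc n)
  let ?k = "\<lambda>w. toda_kernel (Suc n) n x w (complex_of_real (Re (\<i> * lam (Suc n))))
      * whittaker n (imag_part lam) w"
  have k: "?k w = complex_of_real (norm (?k w))" for w
    unfolding norm_mult of_real_mult of_real_norm_toda_kernel Suc.IH ..
  have "whittaker (Suc n) (imag_part lam) x = (\<integral>w. ?k w \<partial>lebR n)"
    unfolding whittaker_Suc_toda_kernel i_imag_part ..
  also have "\<dots> = complex_of_real (\<integral>w. norm (?k w) \<partial>lebR n)"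
    by (subst k, rule integral_complex_of_real)
  finally show ?case by simp
qed simp

lemma norm_whittaker_le: "norm (whittaker n lam x) \<le> norm (whittaker n (imag_part lam) x)"
proof (induction n arbitrary: x)
  case (Suc n)
  let ?k = "\<lambda>w. toda_kernel (Suc n) n x w (complex_of_real (Re (\<i> * lam (Suc n))))
      * whittaker n (imag_part lam) w"
  have k: "?k w = complex_of_real (norm (?k w))" for w
    unfolding norm_mult of_real_mult of_real_norm_toda_kernel of_real_norm_whittaker ..
  have "norm (whittaker (Suc n) lam x) \<le> (\<integral>w. norm (toda_kernel (Suc n) n x w (\<i> * lam (Suc n))
      * whittaker n lam w) \<partial>lebR n)"
    unfolding whittaker_Suc_toda_kernel by (rule integral_norm_bound)
  also have "\<dots> \<le> (\<integral>w. norm (?k w) \<partial>lebR n)"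
  proof (rule integral_mono)
    show "integrable (lebR n) (\<lambda>w. norm (toda_kernel (Suc n) n x w (\<i> * lam (Suc n))
        * whittaker n lam w))"
      using integrable_whittaker[of n x _ 1] by (intro integrable_norm) simp
    show "integrable (lebR n) (\<lambda>w. norm (?k w))"
      using integrable_whittaker[of n x _ 1] by (intro integrable_norm) simp
    show "norm (toda_kernel (Suc n) n x w (\<i> * lam (Suc n)) * whittaker n lam w) \<le> norm (?k w)"
        for w
      unfolding norm_mult by (intro mult_mono norm_toda_kernel_le_Re Suc.IH) auto
  qed
  also have "\<dots> = norm (complex_of_real (\<integral>w. norm (?k w) \<partial>lebR n))" by simp
  also have "complex_of_real (\<integral>w. norm (?k w) \<partial>lebR n) = (\<integral>w. ?k w \<partial>lebR n)"
    by (subst (2) k, rule integral_complex_of_real[symmetric])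
  also have "\<dots> = whittaker (Suc n) (imag_part lam) x"
    unfolding whittaker_Suc_toda_kernel i_imag_part ..
  finally show ?case .
qed simp

text \<open>
  The eigenvalue on the Whittaker function of rank \<open>n\<close>, apart from the factor \<open>\<Gamma> (2 a)\<close>, which
  belongs to the kernel.
\<close>
definition baxter_eigenvalue :: "nat \<Rightarrow> (nat \<Rightarrow> complex) \<Rightarrow> complex \<Rightarrow> complex" where
  "baxter_eigenvalue n lam a = (\<Prod>i=1..n. Gamma (\<i> * lam i + a) * Gamma (- \<i> * lam i + a))"

text \<open>
  Tonelli's theorem for real parameters. The first integrand can be integrated over its Whittaker
  variable by the eigenvalue equation of rank \<open>n\<close>, leaving the integrand of the Whittaker function
  of rank \<open>n + 1\<close>; the exchange relation carries the finiteness to the second.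
\<close>
lemma whittaker_step_integrable_real:
  fixes lam :: "nat \<Rightarrow> complex" and a b :: real
  assumes lam: "imag_part lam = lam"
    and IH: "\<And>y. integrable (lebR n) (\<lambda>x. toda_kernel n n y x (- complex_of_real a)
        * whittaker n lam x)"
      "\<And>y. (\<integral>x. toda_kernel n n y x (- complex_of_real a) * whittaker n lam x \<partial>lebR n) = c
          * whittaker n lam y"
    and b: "\<bar>b\<bar> < a"
  shows "integrable (lebR n \<Otimes>\<^sub>M lebR n) (\<lambda>v. (toda_kernel (Suc n) n y (fst v) b
      * toda_kernel n n (fst v) (snd v) (- complex_of_real a)) * whittaker n lam (snd v))"
    and "integrable (lebR n \<Otimes>\<^sub>M lebR (Suc n)) (\<lambda>v.
        (toda_kernel (Suc n) (Suc n) y (snd v) (- complex_of_real a)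
        * toda_kernel (Suc n) n (snd v) (fst v) b) * whittaker n lam (fst v))"
proof -
  let ?X = "lebR n" and ?X' = "lebR (Suc n)"
  interpret XX: pair_sigma_finite ?X ?X using sigma_finite_lebR by (simp add: pair_sigma_finite_def)
  have W: "complex_of_real (norm (whittaker n lam x)) = whittaker n lam x" for x
    using of_real_norm_whittaker[of n lam] unfolding lam .
  have K: "complex_of_real (norm (toda_kernel l m y x (complex_of_real r))) = toda_kernel l m y x r"
     "complex_of_real (norm (toda_kernel l m y x (- complex_of_real r)))
         = toda_kernel l m y x (- complex_of_real r)" for l m y x r
    using of_real_norm_toda_kernel[of l m y x r] of_real_norm_toda_kernel[of l m y x "- r"]
        by simp_all
  show g: "integrable (?X \<Otimes>\<^sub>M ?X) (\<lambda>v. (toda_kernel (Suc n) n y (fst v) b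
      * toda_kernel n n (fst v) (snd v) (- complex_of_real a)) * whittaker n lam (snd v))"
  proof (rule XX.Fubini_integrable)
    show "(\<lambda>v. (toda_kernel (Suc n) n y (fst v) b
        * toda_kernel n n (fst v) (snd v) (- complex_of_real a)) * whittaker n lam (snd v))
        \<in> borel_measurable (?X \<Otimes>\<^sub>M ?X)"
      by (intro borel_measurable_times measurable_compose[OF measurable_fst measurable_whittaker]
          measurable_compose[OF measurable_snd measurable_whittaker] measurable_toda_kernel
              measurable_pair_component) auto
    have "(\<integral>w. norm ((toda_kernel (Suc n) n y x b * toda_kernel n n x w (- complex_of_real a))
        * whittaker n lam w) \<partial>?X)
       = norm (toda_kernel (Suc n) n y x b * (c * whittaker n lam x))" for x
    proof -
      have "complex_of_real (\<integral>w. norm ((toda_kernel (Suc n) n y x b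
          * toda_kernel n n x w (- complex_of_real a)) * whittaker n lam w) \<partial>?X)
        = (\<integral>w. toda_kernel (Suc n) n y x b * (toda_kernel n n x w (- complex_of_real a)
            * whittaker n lam w) \<partial>?X)"
        unfolding integral_complex_of_real[symmetric] norm_mult of_real_mult W K
            by (simp add: mult.assoc)
      also have "\<dots> = toda_kernel (Suc n) n y x b * (c * whittaker n lam x)"
        using IH(2)[of x] by simp
      finally have "norm (complex_of_real (\<integral>w. norm
          ((toda_kernel (Suc n) n y x b * toda_kernel n n x w (- complex_of_real a))
          * whittaker n lam w) \<partial>?X)) = norm \<dots>"
        by simp
      then show ?thesis by simp
    qed
    then show "integrable ?X (\<lambda>x. \<integral>w. norm (toda_kernel (Suc n) n y (fst (x, w)) b
        * toda_kernel n n (fst (x, w)) (snd (x, w)) (- complex_of_real a)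
        * whittaker n lam (snd (x, w))) \<partial>?X)"
      using integrable_norm[OF integrable_whittaker[of n y b c lam]] by simp
    show "AE x in ?X. integrable ?X (\<lambda>w. toda_kernel (Suc n) n y (fst (x, w)) b
        * toda_kernel n n (fst (x, w)) (snd (x, w)) (- complex_of_real a)
        * whittaker n lam (snd (x, w)))"
      using IH(1) by (simp add: mult.assoc)
  qed
  define s where "s = complex_of_real (a - b)"
  define p where "p = complex_of_real (a + b)"
  have sp: "Re s > 0" "Re p > 0" "- complex_of_real a = - ((p + s) / 2)"
      "complex_of_real b = (p - s) / 2"
    using b by (auto simp: s_def p_def field_simps)
  let ?f = "\<lambda>w x. (toda_kernel (Suc n) (Suc n) y x (- complex_of_real a)
      * toda_kernel (Suc n) n x w b) * whittaker n lam w"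
  let ?g = "\<lambda>w x. (toda_kernel (Suc n) n y x b * toda_kernel n n x w (- complex_of_real a))
      * whittaker n lam w"
  show "integrable (?X \<Otimes>\<^sub>M ?X') (\<lambda>v. ?f (fst v) (snd v))"
  proof (rule fubini_integrable_transfer[OF sigma_finite_lebR sigma_finite_lebR sigma_finite_lebR,
      where f = ?f and g = ?g])
    show "(\<lambda>v. ?f (fst v) (snd v)) \<in> borel_measurable (?X \<Otimes>\<^sub>M ?X')"
      by (intro borel_measurable_times measurable_compose[OF measurable_fst measurable_whittaker]
          measurable_compose[OF measurable_snd measurable_whittaker] measurable_toda_kernel
              measurable_pair_component) auto
    show "integrable (?X \<Otimes>\<^sub>M ?X) (\<lambda>v. ?g (snd v) (fst v))" by (rule g)
    show "integrable ?X' (?f w)" for w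
      using toda_kernel_exchange(1)[OF sp(1,2), of n y w] unfolding sp(3,4) by simp
    show "(\<integral>x. norm (?f w x) \<partial>?X') \<le> norm (Gamma s * Gamma p) * (\<integral>x. norm (?g w x) \<partial>?X)" for w
    proof -
      have "complex_of_real (\<integral>x. norm (?f w x) \<partial>?X') = (\<integral>x. ?f w x \<partial>?X')"
        unfolding integral_complex_of_real[symmetric] norm_mult of_real_mult W K ..
      also have "\<dots> = Gamma s * Gamma p * (\<integral>x. ?g w x \<partial>?X)"
        using toda_kernel_exchange(2)[OF sp(1,2), of n y w] unfolding sp(3,4) by simp
      also have "(\<integral>x. ?g w x \<partial>?X) = complex_of_real (\<integral>x. norm (?g w x) \<partial>?X)"
        unfolding integral_complex_of_real[symmetric] norm_mult of_real_mult W K ..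
      finally show ?thesis by (rule le_of_complex_eq) simp
    qed
  qed
qed

text \<open>
  Insert the recursion for the Whittaker function, exchange the kernels and apply the equation of
  rank \<open>n\<close> to the inner integral. The induction is over all parameters, because the real
  parameters of the majorants also need the equation of rank \<open>n\<close>.
\<close>
lemma toda_kernel_whittaker:
  assumes "Re a > 0" "\<And>i. i \<in> {1..n} \<Longrightarrow> \<bar>Im (lam i)\<bar> < Re a"
  shows "integrable (lebR n) (\<lambda>x. toda_kernel n n y x (- a) * whittaker n lam x) \<and>
    (\<integral>x. toda_kernel n n y x (- a) * whittaker n lam x \<partial>lebR n) = baxter_eigenvalue n lam a
        * whittaker n lam y"
  using assms
proof (induction n arbitrary: a lam y)
  case 0
  show ?case
    using integrable_sites[of 0 "\<lambda>_ _. 0" 1] integral_sites[of 0 "\<lambda>_ _. 0" 1]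
        by (simp add: toda_kernel_def baxter_eigenvalue_def)
next
  case (Suc n)
  let ?X = "lebR n" and ?X' = "lebR (Suc n)"
  define b where "b = \<i> * lam (Suc n)"
  interpret XX: pair_sigma_finite ?X ?X using sigma_finite_lebR by (simp add: pair_sigma_finite_def)
  interpret XX': pair_sigma_finite ?X ?X' using sigma_finite_lebR
      by (simp add: pair_sigma_finite_def)
  have IH: "integrable ?X (\<lambda>x. toda_kernel n n y x (- a) * whittaker n lam x)"
    "(\<integral>x. toda_kernel n n y x (- a) * whittaker n lam x \<partial>?X) = baxter_eigenvalue n lam a
        * whittaker n lam y" for y
    using Suc.IH[of a lam y] Suc.prems by auto
  let ?im = "imag_part lam"
  have im: "Im (?im i) = Im (lam i)" for i by (simp add: imag_part_def)
  have IHr: "integrable ?X (\<lambda>x. toda_kernel n n y x (- complex_of_real (Re a)) * whittaker n ?im x)"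
    "(\<integral>x. toda_kernel n n y x (- complex_of_real (Re a)) * whittaker n ?im x \<partial>?X)
       = baxter_eigenvalue n ?im (complex_of_real (Re a)) * whittaker n ?im y" for y
    using Suc.IH[of "complex_of_real (Re a)" ?im y] Suc.prems im by auto
  have mumu: "imag_part ?im = ?im" by (simp add: imag_part_def fun_eq_iff)
  have br: "\<bar>Re b\<bar> < Re a" using Suc.prems(2)[of "Suc n"] by (simp add: b_def)
  note real = whittaker_step_integrable_real[OF mumu IHr br]
  let ?f = "\<lambda>w x. (toda_kernel (Suc n) (Suc n) y x (- a) * toda_kernel (Suc n) n x w b)
      * whittaker n lam w"
  let ?g = "\<lambda>w x. (toda_kernel (Suc n) n y x b * toda_kernel n n x w (- a)) * whittaker n lam w"
  have g: "integrable (?X \<Otimes>\<^sub>M ?X) (\<lambda>v. ?g (snd v) (fst v))"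
  proof (rule Bochner_Integration.integrable_bound[OF real(1)])
    show "(\<lambda>v. ?g (snd v) (fst v)) \<in> borel_measurable (?X \<Otimes>\<^sub>M ?X)"
      by (intro borel_measurable_times measurable_compose[OF measurable_fst measurable_whittaker]
          measurable_compose[OF measurable_snd measurable_whittaker] measurable_toda_kernel
              measurable_pair_component) auto
    show "AE v in ?X \<Otimes>\<^sub>M ?X. norm (?g (snd v) (fst v))
        \<le> norm (toda_kernel (Suc n) n y (fst v) (complex_of_real (Re b)) *
      toda_kernel n n (fst v) (snd v) (- complex_of_real (Re a)) * whittaker n ?im (snd v))"
      unfolding norm_mult using norm_toda_kernel_le_Re[of _ _ _ _ b]
          norm_toda_kernel_le_Re[of _ _ _ _ "- a"]
      by (intro AE_I2 mult_mono norm_whittaker_le mult_nonneg_nonneg norm_ge_zero) auto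
  qed
  have f: "integrable (?X \<Otimes>\<^sub>M ?X') (\<lambda>v. ?f (fst v) (snd v))"
  proof (rule Bochner_Integration.integrable_bound[OF real(2)])
    show "(\<lambda>v. ?f (fst v) (snd v)) \<in> borel_measurable (?X \<Otimes>\<^sub>M ?X')"
      by (intro borel_measurable_times measurable_compose[OF measurable_fst measurable_whittaker]
          measurable_compose[OF measurable_snd measurable_whittaker] measurable_toda_kernel
              measurable_pair_component) auto
    show "AE v in ?X \<Otimes>\<^sub>M ?X'. norm (?f (fst v) (snd v))
        \<le> norm (toda_kernel (Suc n) (Suc n) y (snd v) (- complex_of_real (Re a)) *
      toda_kernel (Suc n) n (snd v) (fst v) (complex_of_real (Re b)) * whittaker n ?im (fst v))"
      unfolding norm_mult using norm_toda_kernel_le_Re[of _ _ _ _ b]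
          norm_toda_kernel_le_Re[of _ _ _ _ "- a"]
      by (intro AE_I2 mult_mono norm_whittaker_le mult_nonneg_nonneg norm_ge_zero) auto
  qed
  define s where "s = a - b"
  define p where "p = a + b"
  have sp: "Re s > 0" "Re p > 0" "- a = - ((p + s) / 2)" "b = (p - s) / 2"
    using br by (auto simp: s_def p_def field_simps)
  have eq: "(\<integral>x. ?f w x \<partial>?X') = Gamma s * Gamma p * (\<integral>x. ?g w x \<partial>?X)" for w
    using toda_kernel_exchange(2)[OF sp(1,2), of n y w] unfolding sp(3,4) by simp
  have fg: "(\<integral>v. ?f (fst v) (snd v) \<partial>(?X \<Otimes>\<^sub>M ?X')) = Gamma s * Gamma p
      * (\<integral>v. ?g (snd v) (fst v) \<partial>(?X \<Otimes>\<^sub>M ?X))"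
    by (rule fubini_integral_eq[OF sigma_finite_lebR sigma_finite_lebR sigma_finite_lebR f g eq])
  have f': "integrable (?X \<Otimes>\<^sub>M ?X') (\<lambda>(w, x). ?f w x)" using f by (simp add: case_prod_beta')
  have inner: "(\<integral>w. ?f w x \<partial>?X) = toda_kernel (Suc n) (Suc n) y x (- a) * whittaker (Suc n) lam x"
      for x
    unfolding whittaker_Suc_toda_kernel b_def[symmetric] by (simp add: mult.assoc)
  have "(\<integral>x. toda_kernel (Suc n) (Suc n) y x (- a) * whittaker (Suc n) lam x \<partial>?X')
      = (\<integral>v. ?f (fst v) (snd v) \<partial>(?X \<Otimes>\<^sub>M ?X'))"
    using XX'.integral_snd[OF f'] unfolding inner by (simp add: case_prod_beta')
  also have "\<dots> = Gamma s * Gamma p * (\<integral>x. (\<integral>w. ?g w x \<partial>?X) \<partial>?X)"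
    using fg XX.integral_fst'[OF g] by simp
  also have "(\<integral>x. (\<integral>w. ?g w x \<partial>?X) \<partial>?X)
      = (\<integral>x. baxter_eigenvalue n lam a * (toda_kernel (Suc n) n y x b * whittaker n lam x) \<partial>?X)"
  proof (intro Bochner_Integration.integral_cong refl)
    fix x
    have "(\<integral>w. ?g w x \<partial>?X) = toda_kernel (Suc n) n y x b
        * (\<integral>w. toda_kernel n n x w (- a) * whittaker n lam w \<partial>?X)"
      by (simp only: mult.assoc integral_mult_right_zero)
    then show "(\<integral>w. ?g w x \<partial>?X) = baxter_eigenvalue n lam a
        * (toda_kernel (Suc n) n y x b * whittaker n lam x)"
      unfolding IH(2) by (simp only: mult.left_commute)
  qed
  also have "(\<integral>x. baxter_eigenvalue n lam a * (toda_kernel (Suc n) n y x b * whittaker n lam x) \<partial>?X)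
      = baxter_eigenvalue n lam a * whittaker (Suc n) lam y"
    unfolding whittaker_Suc_toda_kernel b_def[symmetric] by (rule integral_mult_right_zero)
  finally have "(\<integral>x. toda_kernel (Suc n) (Suc n) y x (- a) * whittaker (Suc n) lam x \<partial>?X')
    = baxter_eigenvalue (Suc n) lam a * whittaker (Suc n) lam y"
    by (simp add: baxter_eigenvalue_def s_def p_def b_def mult_ac add.commute)
  moreover have "integrable ?X' (\<lambda>x. toda_kernel (Suc n) (Suc n) y x (- a)
      * whittaker (Suc n) lam x)"
    using XX'.integrable_snd[OF f'] unfolding inner .
  ultimately show ?case by blast
qed

theorem corollary6p2:
  fixes l :: nat and lam :: "nat \<Rightarrow> complex" and \<gamma> :: complex and y :: "nat \<Rightarrow> real"
  assumes "1 \<le> l"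
    and "\<And>i. i \<in> {1..l} \<Longrightarrow> \<bar>Im (lam i)\<bar> < Im \<gamma>"
  shows "(\<integral>x. baxter_kernel l y x (- \<gamma>) * whittaker l lam x \<partial>lebR l)
    = Gamma (- 2 * \<i> * \<gamma>)
      * (\<Prod>i=1..l. Gamma (\<i> * lam i - \<i> * \<gamma>))
      * (\<Prod>i=1..l. Gamma (- \<i> * lam i - \<i> * \<gamma>))
      * whittaker l lam y"
proof -
  have pos: "Im \<gamma> > 0" using assms(2)[of l] assms(1) by (auto intro: le_less_trans[OF abs_ge_zero])
  have "(\<integral>x. toda_kernel l l y x (- (- \<i> * \<gamma>)) * whittaker l lam x \<partial>lebR l)
      = baxter_eigenvalue l lam (- \<i> * \<gamma>) * whittaker l lam y"
    using toda_kernel_whittaker[of "- \<i> * \<gamma>" l lam y] pos assms(2) by auto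
  moreover have "baxter_eigenvalue l lam (- \<i> * \<gamma>)
      = (\<Prod>i=1..l. Gamma (\<i> * lam i - \<i> * \<gamma>)) * (\<Prod>i=1..l. Gamma (- \<i> * lam i - \<i> * \<gamma>))"
    unfolding baxter_eigenvalue_def prod.distrib[symmetric]
    by simp
  ultimately show ?thesis
    unfolding baxter_kernel_eq_toda_kernel[OF pos] by (simp add: mult.assoc)
qed

end
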